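(* Let $\kappa,\tau,H\in\mathbb{R}$ and let $\widetilde a,\widetilde b\in\mathbb{C}$ satisfy $(\kappa+4H^2)\widetilde a+2i(H+i\tau)\widetilde b=0$. Then, for every spacelike surface $\Sigma$ immersed in $\mathbb{L}(\kappa,H)$ with constant mean curvature $\tau$, the quadratic differential $\widetilde Q_{\widetilde a,\widetilde b}$ is holomorphic on $\Sigma$ (with respect to the conformal structure of the induced metric and the orientation given by $J$).
   Context: $\mathbb{L}(\kappa,H)$ is the simply connected Lorentzian 3-manifold with a Killing submersion over the complete simply connected surface $\mathbb{M}^2(\kappa)$ of constant curvature $\kappa$, with constant bundle curvature $H$ and fibers the integral curves of a unit timelike Killing field. Put $\lambda=(1+\frac{\kappa}{4}(x^2+y^2))^{-1}$ on $\Omega_\kappa=\{(x,y)\in\mathbb{R}^2:1+\frac{\kappa}{4}(x^2+y^2)>0\}$. Locally (globally if $\kappa\le0$) $\mathbb{L}(\kappa,H)$ is modeled by $\Omega_\kappa\times\mathbb{R}$ with the metric $$\lambda^2(dx^2+dy^2)-(dz-H\lambda(y\,dx-x\,dy))^2,$$ the submersion is $(x,y,z)\mapsto(x,y)$, and $\widetilde E_3=\partial_z$ is the unit timelike Killing field. The ambient orientation is the usual one of $\mathbb{R}^3$. For a spacelike immersed surface, $\widetilde N$ is the upward-pointing unit normal (positive $\partial_z$-component), $JX=\widetilde N\times X$ with $\langle\widetilde N\times X,Y\rangle=\det(\widetilde N,X,Y)$ (equivalently, rotation by $+\frac{\pi}{2}$ for the orientation projecting to the standard orientation of the $(x,y)$-base),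 and $\widetilde\sigma(X,Y)=\langle\widetilde\nabla_XY,\widetilde N\rangle$ is the second fundamental form, $\widetilde\nabla$ being the Levi-Civita connection. Constant mean curvature $\tau$ means $\mathrm{trace}(\widetilde\sigma)=-2\tau$ with respect to the induced metric. With complex-bilinear extensions, $$\widetilde Q_{\widetilde a,\widetilde b}(X,Y)=\widetilde a\,\widetilde\sigma(X-iJX,Y-iJY)+\widetilde b\,\langle X-iJX,\widetilde E_3\rangle\langle Y-iJY,\widetilde E_3\rangle,$$ which is a quadratic differential of type $(2,0)$; it is holomorphic if in any local conformal parameter $\zeta$ it equals $f(\zeta)\,d\zeta^2$ with $f$ holomorphic. *)

theory Defs
  imports "HOL-Complex_Analysis.Complex_Analysis"
begin

unbundle no fps_syntax

section \<open>Smooth maps on open sets\<close>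

text \<open>For open \<open>S\<close> in a finite-dimensional space this is the usual \<open>C\<^sup>k\<close> condition.\<close>

fun Ck_on :: "nat \<Rightarrow> 'a::euclidean_space set \<Rightarrow> ('a \<Rightarrow> 'b::real_normed_vector) \<Rightarrow> bool" where
  "Ck_on 0 S f \<longleftrightarrow> continuous_on S f"
| "Ck_on (Suc k) S f \<longleftrightarrow> (\<forall>x\<in>S. f differentiable (at x)) \<and>
     (\<forall>v. Ck_on k S (\<lambda>x. frechet_derivative f (at x) v))"

definition smooth_on :: "'a::euclidean_space set \<Rightarrow> ('a \<Rightarrow> 'b::real_normed_vector) \<Rightarrow> bool" where
  "smooth_on S f \<longleftrightarrow> (\<forall>k. Ck_on k S f)"


section \<open>Smooth surfaces\<close>

text \<open>A surface is a topological space \<open>T\<close> with an atlas \<open>A\<close> of local parametrizations \<open>(U, p)\<close>,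
  that is, of inverses \<open>p\<close> of coordinate charts with values in \<open>U \<subseteq> \<complex>\<close>, where \<open>\<complex>\<close> stands for the
  real plane.\<close>

definition is_parametrization :: "'s topology \<Rightarrow> complex set \<Rightarrow> (complex \<Rightarrow> 's) \<Rightarrow> bool" where
  "is_parametrization T U p \<longleftrightarrow>
     open U \<and> openin T (p ` U) \<and>
     homeomorphic_map (top_of_set U) (subtopology T (p ` U)) p"

definition smooth_transition ::
    "complex set \<Rightarrow> (complex \<Rightarrow> 's) \<Rightarrow> complex set \<Rightarrow> (complex \<Rightarrow> 's) \<Rightarrow> bool" where
  "smooth_transition U p V q \<longleftrightarrow>
     smooth_on {z \<in> U. p z \<in> q ` V} (\<lambda>z. inv_into V q (p z))"

definition smooth_surface :: "'s topology \<Rightarrow> (complex set \<times> (complex \<Rightarrow> 's)) set \<Rightarrow> bool" where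
  "smooth_surface T A \<longleftrightarrow>
     Hausdorff_space T \<and> second_countable T \<and>
     (\<forall>(U, p)\<in>A. is_parametrization T U p) \<and>
     topspace T = (\<Union>(U, p)\<in>A. p ` U) \<and>
     (\<forall>(U, p)\<in>A. \<forall>(V, q)\<in>A. smooth_transition U p V q)"

text \<open>The local parametrizations of the maximal atlas generated by \<open>A\<close>.\<close>

definition local_parameters ::
    "'s topology \<Rightarrow> (complex set \<times> (complex \<Rightarrow> 's)) set \<Rightarrow> (complex set \<times> (complex \<Rightarrow> 's)) set" where
  "local_parameters T A =
     {(U, p). is_parametrization T U p \<and>
        (\<forall>(V, q)\<in>A. smooth_transition U p V q \<and> smooth_transition V q U p)}"


section \<open>The model metric\<close>

definition Omega :: "real \<Rightarrow> (real^3) set" where  \<comment> \<open>this is \<open>\<Omega>\<^sub>\<kappa> \<times> \<real>\<close>\<close>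
  "Omega \<kappa> = {p. 1 + \<kappa> / 4 * ((p$1)\<^sup>2 + (p$2)\<^sup>2) > 0}"

definition lam :: "real \<Rightarrow> real^3 \<Rightarrow> real" where
  "lam \<kappa> p = inverse (1 + \<kappa> / 4 * ((p$1)\<^sup>2 + (p$2)\<^sup>2))"

definition metric :: "real \<Rightarrow> real \<Rightarrow> real^3 \<Rightarrow> real^3 \<Rightarrow> real^3 \<Rightarrow> real" where
  "metric \<kappa> H p u v =
     (lam \<kappa> p)\<^sup>2 * (u$1 * v$1 + u$2 * v$2)
     - (u$3 - H * lam \<kappa> p * (p$2 * u$1 - p$1 * u$2))
       * (v$3 - H * lam \<kappa> p * (p$2 * v$1 - p$1 * v$2))"

definition E3 :: "real^3" where
  "E3 = axis 3 1"

text \<open>The Lorentzian volume form for the usual orientation of \<open>\<real>\<^sup>3\<close>; in a positively oriented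
  orthonormal frame it is the determinant of the components.\<close>

definition volume_form :: "real \<Rightarrow> real \<Rightarrow> real^3 \<Rightarrow> real^3 \<Rightarrow> real^3 \<Rightarrow> real^3 \<Rightarrow> real" where
  "volume_form \<kappa> H p u v w =
     sqrt \<bar>det (\<chi> i j. metric \<kappa> H p (axis i 1) (axis j 1) :: real^3^3)\<bar>
     * det (vector [u, v, w] :: real^3^3)"

definition cross_product :: "real \<Rightarrow> real \<Rightarrow> real^3 \<Rightarrow> real^3 \<Rightarrow> real^3 \<Rightarrow> real^3" where
  "cross_product \<kappa> H p u v =
     (THE z. \<forall>w. metric \<kappa> H p z w = volume_form \<kappa> H p u v w)"

definition metric_deriv :: "real \<Rightarrow> real \<Rightarrow> real^3 \<Rightarrow> real^3 \<Rightarrow> real^3 \<Rightarrow> real^3 \<Rightarrow> real" where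
  "metric_deriv \<kappa> H p u v w = frechet_derivative (\<lambda>q. metric \<kappa> H q v w) (at p) u"

text \<open>The Levi-Civita connection is \<open>\<nabla>\<^sub>u V = D\<^sub>u V + \<Gamma>(u, V)\<close>, where the Koszul formula
  for constant fields determines \<open>\<Gamma>\<close>.\<close>

definition christoffel :: "real \<Rightarrow> real \<Rightarrow> real^3 \<Rightarrow> real^3 \<Rightarrow> real^3 \<Rightarrow> real^3" where
  "christoffel \<kappa> H p u v =
     (THE z. \<forall>w. 2 * metric \<kappa> H p z w =
        metric_deriv \<kappa> H p u v w + metric_deriv \<kappa> H p v u w - metric_deriv \<kappa> H p w u v)"


section \<open>The space \<open>\<LL>(\<kappa>, H)\<close>\<close>

text \<open>
  The space is the set \<open>L_space \<kappa> H\<close> together with the family \<open>L_charts \<kappa> H\<close> of surjective local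
  diffeomorphisms from \<open>\<Omega>\<^sub>\<kappa> \<times> \<real>\<close> onto open subsets of it, all of which are required to be local
  isometries carrying \<open>\<partial>\<^sub>z\<close> to the Killing field and preserving the orientation.

  For \<open>\<kappa> \<le> 0\<close> there is one global chart. For \<open>\<kappa> > 0\<close> a chart misses the fiber over
  one point of the base sphere, and a second chart is centred at that fiber; with \<open>w = x + iy\<close>
  the transition is \<open>(w, z) \<mapsto> (4 / (\<kappa> w), z + (4 H / \<kappa>) arg w)\<close>, which is an isometry of the
  model metric preserving \<open>\<partial>\<^sub>z\<close> and the orientation. If \<open>H \<noteq> 0\<close>, the multivalued argument makes
  \<open>z\<close> periodic with period \<open>8 \<pi> H / \<kappa>\<close>; the resulting space is the 3-sphere in \<open>\<complex>\<^sup>2\<close>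
  with the Hopf fibration. If \<open>H = 0\<close>, it is the product of a 2-sphere and the line, where the
  2-sphere is the unit sphere of \<open>\<complex> \<times> \<real>\<close> with its metric divided by \<open>\<kappa>\<close>.
\<close>

definition planar_chart :: "real^3 \<Rightarrow> complex \<times> complex" where
  "planar_chart p = (Complex (p$1) (p$2), complex_of_real (p$3))"

definition hopf_chart :: "real \<Rightarrow> real \<Rightarrow> real^3 \<Rightarrow> complex \<times> complex" where
  "hopf_chart \<kappa> H p =
     (let c = complex_of_real (sqrt (lam \<kappa> p)); u = cis (\<kappa> / (4 * H) * p$3)
      in (c * complex_of_real (sqrt \<kappa> / 2) * Complex (p$1) (p$2) * u, c * u))"

text \<open>Inverse stereographic projections from the two poles; the first component and the
  real part of the second give the point of the sphere.\<close>

definition product_chart :: "real \<Rightarrow> real^3 \<Rightarrow> complex \<times> complex" where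
  "product_chart \<kappa> p =
     (complex_of_real (sqrt \<kappa> * lam \<kappa> p) * Complex (p$1) (p$2), Complex (2 * lam \<kappa> p - 1) (p$3))"

definition product_chart' :: "real \<Rightarrow> real^3 \<Rightarrow> complex \<times> complex" where
  "product_chart' \<kappa> p =
     (complex_of_real (sqrt \<kappa> * lam \<kappa> p) * Complex (p$1) (- p$2), Complex (1 - 2 * lam \<kappa> p) (p$3))"

definition L_charts :: "real \<Rightarrow> real \<Rightarrow> (real^3 \<Rightarrow> complex \<times> complex) set" where
  "L_charts \<kappa> H =
     (if \<kappa> \<le> 0 then {planar_chart}
      else if H = 0 then {product_chart \<kappa>, product_chart' \<kappa>}
      else {hopf_chart \<kappa> H, prod.swap \<circ> hopf_chart \<kappa> H})"

definition L_space :: "real \<Rightarrow> real \<Rightarrow> (complex \<times> complex) set" where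
  "L_space \<kappa> H = (\<Union>\<psi>\<in>L_charts \<kappa> H. \<psi> ` Omega \<kappa>)"


lemma hopf_chart_onto:
  assumes "\<kappa> > 0" "H \<noteq> 0" "(cmod a)\<^sup>2 + (cmod b)\<^sup>2 = 1" "b \<noteq> 0"
  shows "(a, b) \<in> range (hopf_chart \<kappa> H)"
proof -
  define w where "w = complex_of_real (2 / sqrt \<kappa>) * (a / b)"
  define p :: "real^3" where "p = vector [Re w, Im w, 4 * H / \<kappa> * Arg b]"
  have p: "p$1 = Re w" "p$2 = Im w" "p$3 = 4 * H / \<kappa> * Arg b"
    by (auto simp: p_def)
  have "(cmod w)\<^sup>2 = 4 / \<kappa> * ((cmod a)\<^sup>2 / (cmod b)\<^sup>2)"
    using assms(1) by (simp add: w_def norm_mult norm_divide power_mult_distrib power_divide)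
  then have "1 + \<kappa> / 4 * ((p$1)\<^sup>2 + (p$2)\<^sup>2) = 1 + (cmod a)\<^sup>2 / (cmod b)\<^sup>2"
    using assms(1) by (simp add: p cmod_power2 [symmetric])
  also have "\<dots> = 1 / (cmod b)\<^sup>2"
    using assms(3,4) by (simp add: field_simps)
  finally have "sqrt (lam \<kappa> p) = cmod b"
    by (simp add: lam_def)
  moreover have "cis (\<kappa> / (4 * H) * p$3) = b / complex_of_real (cmod b)"
    using assms(1,2,4) cis_Arg[of b] by (simp add: p sgn_eq)
  moreover have "Complex (p$1) (p$2) = w" by (simp add: p)
  moreover have "complex_of_real (sqrt \<kappa> / 2) * w = a / b"
    using assms(1) by (simp add: w_def field_simps)
  ultimately have "hopf_chart \<kappa> H p = (a, b)"
    using assms(4) by (simp add: hopf_chart_def Let_def mult.assoc) 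
  then show ?thesis by (metis rangeI)
qed

lemma L_space_eq_3_sphere:
  assumes "\<kappa> > 0" "H \<noteq> 0"
  shows "L_space \<kappa> H = {(a, b). (cmod a)\<^sup>2 + (cmod b)\<^sup>2 = 1}"
proof -
  have pos: "1 + \<kappa> / 4 * ((p$1)\<^sup>2 + (p$2)\<^sup>2) > 0" for p :: "real^3"
    using assms(1) by (simp add: add_pos_nonneg)
  then have Om: "Omega \<kappa> = UNIV" by (auto simp: Omega_def)
  have *: "(cmod (fst (hopf_chart \<kappa> H p)))\<^sup>2 + (cmod (snd (hopf_chart \<kappa> H p)))\<^sup>2 = 1" for p
  proof -
    let ?r = "(p$1)\<^sup>2 + (p$2)\<^sup>2"
    have "lam \<kappa> p * (1 + \<kappa> / 4 * ?r) = 1" "lam \<kappa> p > 0"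
      using pos[of p] by (auto simp: lam_def)
    then show ?thesis
      using assms(1)
      by (simp add: hopf_chart_def Let_def norm_mult power_mult_distrib cmod_power2 power_divide algebra_simps add_divide_distrib)
  qed
  have "L_space \<kappa> H = range (hopf_chart \<kappa> H) \<union> prod.swap ` range (hopf_chart \<kappa> H)"
    using assms by (auto simp: L_space_def L_charts_def Om)
  also have "\<dots> = {(a, b). (cmod a)\<^sup>2 + (cmod b)\<^sup>2 = 1}" (is "_ = ?S")
  proof (intro equalityI subsetI)
    fix x assume "x \<in> range (hopf_chart \<kappa> H) \<union> prod.swap ` range (hopf_chart \<kappa> H)"
    then show "x \<in> ?S" using * by (auto simp: case_prod_unfold add.commute)
  next
    fix x assume x: "x \<in> ?S"
    obtain a b where ab: "x = (a, b)" "(cmod a)\<^sup>2 + (cmod b)\<^sup>2 = 1" using x by auto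
    show "x \<in> range (hopf_chart \<kappa> H) \<union> prod.swap ` range (hopf_chart \<kappa> H)"
    proof (cases "b = 0")
      case False
      then show ?thesis using hopf_chart_onto[OF assms ab(2)] ab(1) by blast
    next
      case True
      then have "a \<noteq> 0" using ab(2) by auto
      then have "(b, a) \<in> range (hopf_chart \<kappa> H)"
        using hopf_chart_onto[OF assms, of b a] ab(2) by (simp add: add.commute)
      then have "prod.swap (b, a) \<in> prod.swap ` range (hopf_chart \<kappa> H)"
        by (rule imageI)
      then show ?thesis using ab(1) by simp
    qed
  qed
  finally show ?thesis .
qed

lemma product_charts_onto:
  assumes "\<kappa> > 0" "(cmod a)\<^sup>2 + (Re b)\<^sup>2 = 1"
  shows "(a, b) \<in> range (product_chart \<kappa>) \<union> range (product_chart' \<kappa>)"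
proof -
  have key: "\<exists>p::real^3. lam \<kappa> p = l \<and> complex_of_real (sqrt \<kappa> * lam \<kappa> p) * Complex (p$1) (p$2) = c \<and> p$3 = t"
    if l: "l > 0" "(cmod c)\<^sup>2 = 4 * l * (1 - l)" for c l t
  proof -
    define w where "w = c / complex_of_real (sqrt \<kappa> * l)"
    define p :: "real^3" where "p = vector [Re w, Im w, t]"
    have p: "p$1 = Re w" "p$2 = Im w" "p$3 = t" by (auto simp: p_def)
    have "(cmod w)\<^sup>2 = (cmod c)\<^sup>2 / (\<kappa> * l\<^sup>2)"
      using assms(1) l(1) by (simp add: w_def norm_mult norm_divide power_mult_distrib power_divide)
    also have "\<dots> = 4 / \<kappa> * (1 / l - 1)"
      using assms(1) l by (simp add: field_simps power2_eq_square)
    finally have "1 + \<kappa> / 4 * (cmod w)\<^sup>2 = 1 / l"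
      using assms(1) l(1) by (simp add: field_simps)
    then have "1 + \<kappa> / 4 * ((p$1)\<^sup>2 + (p$2)\<^sup>2) = 1 / l"
      by (simp only: p cmod_power2)
    then have "lam \<kappa> p = l" by (simp add: lam_def)
    moreover have "complex_of_real (sqrt \<kappa> * l) * Complex (p$1) (p$2) = c"
      using assms(1) l(1) by (simp add: p w_def complex_eq_iff)
    ultimately show ?thesis using p by auto
  qed
  show ?thesis
  proof (cases "Re b = -1")
    case False
    have "\<bar>Re b\<bar> \<le> 1" using assms(2) by (metis abs_square_le_1 le_add_same_cancel2 zero_le_power2)
    with False have "(1 + Re b) / 2 > 0" by auto
    moreover have "(cmod a)\<^sup>2 = 4 * ((1 + Re b) / 2) * (1 - (1 + Re b) / 2)"
      using assms(2) by (simp add: field_simps power2_eq_square)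
    ultimately obtain p :: "real^3" where "lam \<kappa> p = (1 + Re b) / 2"
      "complex_of_real (sqrt \<kappa> * lam \<kappa> p) * Complex (p$1) (p$2) = a" "p$3 = Im b"
      using key by blast
    then have "product_chart \<kappa> p = (a, b)" by (simp add: product_chart_def complex_eq_iff)
    then show ?thesis by (metis UnI1 rangeI)
  next
    case True
    with assms(2) have "a = 0" by simp
    define p :: "real^3" where "p = vector [0, 0, Im b]"
    have "product_chart' \<kappa> p = (a, b)"
      using True \<open>a = 0\<close> by (simp add: product_chart'_def p_def lam_def complex_eq_iff)
    then show ?thesis by (metis UnI2 rangeI)
  qed
qed

lemma L_space_eq_product:
  assumes "\<kappa> > 0"
  shows "L_space \<kappa> 0 = {(a, b). (cmod a)\<^sup>2 + (Re b)\<^sup>2 = 1}"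
proof -
  have pos: "1 + \<kappa> / 4 * ((p$1)\<^sup>2 + (p$2)\<^sup>2) > 0" for p :: "real^3"
    using assms by (simp add: add_pos_nonneg)
  then have Om: "Omega \<kappa> = UNIV" by (auto simp: Omega_def)
  have *: "\<kappa> * (lam \<kappa> p)\<^sup>2 * ((p$1)\<^sup>2 + (p$2)\<^sup>2) + (2 * lam \<kappa> p - 1)\<^sup>2 = 1" for p
  proof -
    have "lam \<kappa> p * (1 + \<kappa> / 4 * ((p$1)\<^sup>2 + (p$2)\<^sup>2)) = 1" 
      using pos[of p] by (auto simp: lam_def)
    then show ?thesis by algebra
  qed
  have eq: "L_space \<kappa> 0 = range (product_chart \<kappa>) \<union> range (product_chart' \<kappa>)"
    using assms by (auto simp: L_space_def L_charts_def Om)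
  have 1: "(cmod (fst (product_chart \<kappa> p)))\<^sup>2 + (Re (snd (product_chart \<kappa> p)))\<^sup>2 = 1" for p
    using *[of p] assms
    by (simp add: product_chart_def norm_mult power_mult_distrib cmod_power2)
  have 2: "(cmod (fst (product_chart' \<kappa> p)))\<^sup>2 + (Re (snd (product_chart' \<kappa> p)))\<^sup>2 = 1" for p
    using *[of p] assms
    by (simp add: product_chart'_def norm_mult power_mult_distrib cmod_power2 power2_commute)
  show ?thesis
    unfolding eq
  proof (intro equalityI subsetI)
    fix x assume "x \<in> range (product_chart \<kappa>) \<union> range (product_chart' \<kappa>)"
    then show "x \<in> {(a, b). (cmod a)\<^sup>2 + (Re b)\<^sup>2 = 1}"
      using 1 2 by (auto simp: case_prod_unfold)
  next
    fix x :: "complex \<times> complex" assume "x \<in> {(a, b). (cmod a)\<^sup>2 + (Re b)\<^sup>2 = 1}"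
    then show "x \<in> range (product_chart \<kappa>) \<union> range (product_chart' \<kappa>)"
      using product_charts_onto[OF assms, of "fst x" "snd x"] by (simp add: case_prod_unfold)
  qed
qed


section \<open>Geometry of a surface in a local representation\<close>

text \<open>In what follows \<open>F\<close> is a map from an open subset of \<open>\<complex> = \<real>\<^sup>2\<close> to the model, and
  \<open>v, w \<in> \<complex>\<close> are tangent vectors of the parameter domain at \<open>\<zeta>\<close>.\<close>

definition dF :: "(complex \<Rightarrow> real^3) \<Rightarrow> complex \<Rightarrow> complex \<Rightarrow> real^3" where
  "dF F \<zeta> v = frechet_derivative F (at \<zeta>) v"

definition first_ff ::
    "real \<Rightarrow> real \<Rightarrow> (complex \<Rightarrow> real^3) \<Rightarrow> complex \<Rightarrow> complex \<Rightarrow> complex \<Rightarrow> real" where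
  "first_ff \<kappa> H F \<zeta> v w = metric \<kappa> H (F \<zeta>) (dF F \<zeta> v) (dF F \<zeta> w)"

text \<open>Since \<open>E3\<close> is unit timelike, the component of \<open>n\<close> along \<open>E3\<close> in the splitting into vertical
  and horizontal parts is \<open>- metric \<kappa> H p n E3\<close>; upward-pointing means that it is positive.\<close>

definition unit_normal ::
    "real \<Rightarrow> real \<Rightarrow> (complex \<Rightarrow> real^3) \<Rightarrow> complex \<Rightarrow> real^3" where
  "unit_normal \<kappa> H F \<zeta> =
     (THE n. metric \<kappa> H (F \<zeta>) n n = -1 \<and> (\<forall>v. metric \<kappa> H (F \<zeta>) n (dF F \<zeta> v) = 0) \<and>
        - metric \<kappa> H (F \<zeta>) n E3 > 0)"

definition J_op :: "real \<Rightarrow> real \<Rightarrow> (complex \<Rightarrow> real^3) \<Rightarrow> complex \<Rightarrow> complex \<Rightarrow> complex" where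
  "J_op \<kappa> H F \<zeta> v =
     (THE w. dF F \<zeta> w = cross_product \<kappa> H (F \<zeta>) (unit_normal \<kappa> H F \<zeta>) (dF F \<zeta> v))"

definition cov_deriv ::
    "real \<Rightarrow> real \<Rightarrow> (complex \<Rightarrow> real^3) \<Rightarrow> complex \<Rightarrow> complex \<Rightarrow> complex \<Rightarrow> real^3" where
  "cov_deriv \<kappa> H F \<zeta> v w =
     frechet_derivative (\<lambda>z. dF F z w) (at \<zeta>) v
     + christoffel \<kappa> H (F \<zeta>) (dF F \<zeta> v) (dF F \<zeta> w)"

definition second_ff ::
    "real \<Rightarrow> real \<Rightarrow> (complex \<Rightarrow> real^3) \<Rightarrow> complex \<Rightarrow> complex \<Rightarrow> complex \<Rightarrow> real" where
  "second_ff \<kappa> H F \<zeta> v w = metric \<kappa> H (F \<zeta>) (cov_deriv \<kappa> H F \<zeta> v w) (unit_normal \<kappa> H F \<zeta>)"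

text \<open>Complex-linear and complex-bilinear extensions of real forms; the pair \<open>(v, w)\<close> stands
  for the complexified vector \<open>v + \<i> w\<close>.\<close>

definition clin :: "('a \<Rightarrow> real) \<Rightarrow> 'a \<times> 'a \<Rightarrow> complex" where
  "clin l X = Complex (l (fst X)) (l (snd X))"

definition cbilin :: "('a \<Rightarrow> 'a \<Rightarrow> real) \<Rightarrow> 'a \<times> 'a \<Rightarrow> 'a \<times> 'a \<Rightarrow> complex" where
  "cbilin B X Y =
     Complex (B (fst X) (fst Y) - B (snd X) (snd Y)) (B (fst X) (snd Y) + B (snd X) (fst Y))"

definition Q_diff ::
    "real \<Rightarrow> real \<Rightarrow> complex \<Rightarrow> complex \<Rightarrow> (complex \<Rightarrow> real^3) \<Rightarrow> complex
      \<Rightarrow> complex \<Rightarrow> complex \<Rightarrow> complex" where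
  "Q_diff \<kappa> H a b F \<zeta> v w =
     (let X = (v, - J_op \<kappa> H F \<zeta> v); Y = (w, - J_op \<kappa> H F \<zeta> w);
          e = (\<lambda>u. metric \<kappa> H (F \<zeta>) (dF F \<zeta> u) E3)
      in a * cbilin (second_ff \<kappa> H F \<zeta>) X Y + b * clin e X * clin e Y)"


section \<open>Surfaces in \<open>\<LL>(\<kappa>, H)\<close>\<close>

text \<open>\<open>F\<close> represents \<open>\<phi>\<close> in the local parameter \<open>(U, p)\<close> of the surface and the chart \<open>\<psi>\<close> of
  the ambient space. The geometric notions below do not depend on the choice of \<open>\<psi>\<close> and \<open>F\<close>,
  because the transitions between ambient charts are isometries preserving \<open>\<partial>\<^sub>z\<close> and
  the orientation.\<close>

definition local_rep ::
    "real \<Rightarrow> real \<Rightarrow> 's topology \<Rightarrow> (complex set \<times> (complex \<Rightarrow> 's)) set \<Rightarrow> ('s \<Rightarrow> complex \<times> complex)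
      \<Rightarrow> complex set \<Rightarrow> (complex \<Rightarrow> 's) \<Rightarrow> (real^3 \<Rightarrow> complex \<times> complex) \<Rightarrow> (complex \<Rightarrow> real^3) \<Rightarrow> bool" where
  "local_rep \<kappa> H T A \<phi> U p \<psi> F \<longleftrightarrow>
     (U, p) \<in> local_parameters T A \<and> \<psi> \<in> L_charts \<kappa> H \<and>
     F ` U \<subseteq> Omega \<kappa> \<and> smooth_on U F \<and> (\<forall>\<zeta>\<in>U. \<phi> (p \<zeta>) = \<psi> (F \<zeta>))"

definition smooth_into_L ::
    "real \<Rightarrow> real \<Rightarrow> 's topology \<Rightarrow> (complex set \<times> (complex \<Rightarrow> 's)) set \<Rightarrow> ('s \<Rightarrow> complex \<times> complex) \<Rightarrow> bool" where
  "smooth_into_L \<kappa> H T A \<phi> \<longleftrightarrow> \<phi> ` topspace T \<subseteq> L_space \<kappa> H \<and>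
     (\<forall>x\<in>topspace T. \<exists>U p \<psi> F. local_rep \<kappa> H T A \<phi> U p \<psi> F \<and> x \<in> p ` U)"

definition spacelike_immersion ::
    "real \<Rightarrow> real \<Rightarrow> 's topology \<Rightarrow> (complex set \<times> (complex \<Rightarrow> 's)) set \<Rightarrow> ('s \<Rightarrow> complex \<times> complex) \<Rightarrow> bool" where
  "spacelike_immersion \<kappa> H T A \<phi> \<longleftrightarrow> smooth_into_L \<kappa> H T A \<phi> \<and>
     (\<forall>U p \<psi> F. local_rep \<kappa> H T A \<phi> U p \<psi> F \<longrightarrow>
        (\<forall>\<zeta>\<in>U. inj (dF F \<zeta>) \<and> (\<forall>v. v \<noteq> 0 \<longrightarrow> first_ff \<kappa> H F \<zeta> v v > 0)))"

text \<open>The trace of the second fundamental form is computed in orthonormal bases of the induced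
  metric; note the normalization \<open>-2 \<tau>\<close>.\<close>

definition has_cmc ::
    "real \<Rightarrow> real \<Rightarrow> 's topology \<Rightarrow> (complex set \<times> (complex \<Rightarrow> 's)) set \<Rightarrow> ('s \<Rightarrow> complex \<times> complex)
      \<Rightarrow> real \<Rightarrow> bool" where
  "has_cmc \<kappa> H T A \<phi> \<tau> \<longleftrightarrow>
     (\<forall>U p \<psi> F. local_rep \<kappa> H T A \<phi> U p \<psi> F \<longrightarrow>
        (\<forall>\<zeta>\<in>U. \<forall>e1 e2. first_ff \<kappa> H F \<zeta> e1 e1 = 1 \<and> first_ff \<kappa> H F \<zeta> e2 e2 = 1 \<and>
           first_ff \<kappa> H F \<zeta> e1 e2 = 0 \<longrightarrow>
             second_ff \<kappa> H F \<zeta> e1 e1 + second_ff \<kappa> H F \<zeta> e2 e2 = -2 * \<tau>))"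

text \<open>Conformal for the induced metric, and positively oriented, i.e. \<open>(v, J v)\<close> is a positive
  basis of \<open>\<complex>\<close>.\<close>

definition conformal_rep :: "real \<Rightarrow> real \<Rightarrow> complex set \<Rightarrow> (complex \<Rightarrow> real^3) \<Rightarrow> bool" where
  "conformal_rep \<kappa> H U F \<longleftrightarrow>
     (\<forall>\<zeta>\<in>U. (\<exists>\<mu>>0. \<forall>v w. first_ff \<kappa> H F \<zeta> v w = \<mu> * inner v w) \<and>
        (\<forall>v. v \<noteq> 0 \<longrightarrow> Im (cnj v * J_op \<kappa> H F \<zeta> v) > 0))"

text \<open>In a conformal parameter \<open>\<zeta>\<close> the differential equals \<open>f(\<zeta>) d\<zeta>\<^sup>2\<close> with \<open>f\<close> holomorphic, where
  \<open>d\<zeta>\<^sup>2(v, w) = v w\<close>. As holomorphy is local, it suffices to use parameter domains that are mapped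
  into one ambient chart.\<close>

definition Q_holomorphic ::
    "real \<Rightarrow> real \<Rightarrow> complex \<Rightarrow> complex \<Rightarrow> 's topology \<Rightarrow> (complex set \<times> (complex \<Rightarrow> 's)) set
      \<Rightarrow> ('s \<Rightarrow> complex \<times> complex) \<Rightarrow> bool" where
  "Q_holomorphic \<kappa> H a b T A \<phi> \<longleftrightarrow>
     (\<forall>U p \<psi> F. local_rep \<kappa> H T A \<phi> U p \<psi> F \<and> conformal_rep \<kappa> H U F \<longrightarrow>
        (\<exists>f. f holomorphic_on U \<and> (\<forall>\<zeta>\<in>U. \<forall>v w. Q_diff \<kappa> H a b F \<zeta> v w = f \<zeta> * (v * w))))"

end

theory Submission
  imports Defs
begin

text \<open>
  In the global frame of the Killing submersion the pulled-back Levi-Civita connection is flat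
  differentiation plus an explicit Lorentz-skew bilinear map. In a positively oriented conformal
  parameter with \<open>X = F\<^sub>u\<close>, \<open>Y = F\<^sub>v\<close> and \<open>\<mu> = \<langle>X, X\<rangle>\<close>, constant mean curvature means
  \<open>\<nabla>\<^sub>u X + \<nabla>\<^sub>v Y = 2 \<tau> \<mu> N\<close>. Hence in the Cauchy-Riemann expression \<open>f\<^sub>u + \<i> f\<^sub>v\<close> of the
  coefficient \<open>f\<close> of the differential, Codazzi's equation leaves from the first summand only an
  ambient curvature term, a multiple of \<open>(\<kappa> + 4 H\<^sup>2) a\<close>; as the vertical field is Killing, the
  second summand contributes the same multiple of \<open>2 \<i> (H + \<i> \<tau>) b\<close>.
\<close>

no_notation fps_nth (infixl \<open>$\<close> 75)

section \<open>Calculus of smooth maps\<close>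

text \<open>The normal, cross product, Christoffel map and J are given by definite descriptions.
  Since \<open>frame\<close> maps each tangent space isometrically onto one fixed Minkowski space,
  each is evaluated by exhibiting a single vector there; nondegeneracy gives uniqueness. The
  constant \<kappa> + 4H^2 measures the deviation from constant curvature: with \<times> denoting
  \<open>lorentz_cross\<close>, \<open>curv\<close> is H^2 (X \<times> Y) \<times> V plus \<kappa> +
  4H^2 times a rotation of the horizontal part of V. For tangent V the first term is again tangent,
  so Codazzi's equation sees only the second. The factor H + i\<tau> has two sources. As the
  covariant derivative of E3 along W is H (W \<times> E3), the skew part of the derivative of the
  form <., E3> on the surface gives H, and its trace gives \<tau>. Both summands of the
  Cauchy-Riemann expression share the factor <X - iY, E3>, so the linear relation between a and b
  suffices and that factor may vanish. Orientation enters only through a sign: conformality alone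
  determines the normal up to the sign of its vertical component, hence J up to multiplication by i
  or -i.\<close>

abbreviation dir_deriv :: "'a::real_normed_vector \<Rightarrow> ('a \<Rightarrow> 'b::real_normed_vector) \<Rightarrow> 'a \<Rightarrow> 'b" where
  "dir_deriv v f x \<equiv> frechet_derivative f (at x) v"

lemma dir_deriv_eqI: "(f has_derivative f') (at x) \<Longrightarrow> dir_deriv v f x = f' v"
  by (metis frechet_derivative_at)

text \<open>Derivative formulas are available only at points of \<open>S\<close>, while
  \<open>Ck_on\<close> refers to \<open>frechet_derivative\<close> as a function on the whole space.
  Openness makes derivatives on \<open>S\<close> depend only on values in \<open>S\<close>, so such
  formulas may be substituted.\<close>

lemma Ck_on_cong:
  assumes "open S" "\<And>x. x \<in> S \<Longrightarrow> f x = g x"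
  shows "Ck_on k S f \<longleftrightarrow> Ck_on k S g"
  using assms(2)
proof (induction k arbitrary: f g)
  case 0
  then show ?case by (auto cong: continuous_on_cong)
next
  case (Suc k)
  have "f differentiable (at x) \<longleftrightarrow> g differentiable (at x)" if "x \<in> S" for x
    using has_derivative_transform_within_open[OF _ assms(1) that, of f _ UNIV g]
      has_derivative_transform_within_open[OF _ assms(1) that, of g _ UNIV f] Suc.prems
    unfolding differentiable_def by metis
  moreover have "dir_deriv v f x = dir_deriv v g x" if "f differentiable (at x)" "x \<in> S" for v x
    using frechet_derivative_transform_within_open[OF that(1) assms(1) that(2)] Suc.prems by metis
  ultimately show ?case
    using Suc.IH[of "dir_deriv v f" "dir_deriv v g" for v] by (auto; metis)
qed

lemma Ck_on_SucD: "Ck_on (Suc k) S f \<Longrightarrow> Ck_on k S f"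
proof (induction k arbitrary: f)
  case 0
  then show ?case
    by (auto intro!: continuous_at_imp_continuous_on differentiable_imp_continuous_within)
next
  case (Suc k)
  then show ?case by (metis Ck_on.simps(2))
qed

lemma Ck_on_bounded_linear:
  assumes "bounded_linear h" "open S"
  shows "Ck_on k S f \<Longrightarrow> Ck_on k S (\<lambda>x. h (f x))"
proof (induction k arbitrary: f)
  case 0
  then show ?case using bounded_linear.continuous_on[OF assms(1)] by simp
next
  case (Suc k)
  have *: "((\<lambda>x. h (f x)) has_derivative (\<lambda>v. h (dir_deriv v f x))) (at x)" if "x \<in> S" for x
    using Suc.prems that bounded_linear.has_derivative[OF assms(1)] 
    by (auto simp: frechet_derivative_works)
  have "Ck_on k S (dir_deriv v (\<lambda>x. h (f x)))" for v
    using Suc.IH[of "dir_deriv v f"] Suc.prems 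
      Ck_on_cong[OF assms(2), of "dir_deriv v (\<lambda>x. h (f x))" "\<lambda>x. h (dir_deriv v f x)"] 
      dir_deriv_eqI[OF *] by auto
  then show ?case using * by (auto simp: differentiable_def)
qed

lemma Ck_on_add:
  assumes "open S"
  shows "Ck_on k S f \<Longrightarrow> Ck_on k S g \<Longrightarrow> Ck_on k S (\<lambda>x. f x + g x)"
proof (induction k arbitrary: f g)
  case 0
  then show ?case by (auto intro: continuous_intros)
next
  case (Suc k)
  have *: "((\<lambda>x. f x + g x) has_derivative (\<lambda>v. dir_deriv v f x + dir_deriv v g x)) (at x)" if "x \<in> S" for x
    using Suc.prems that by (auto simp: frechet_derivative_works intro: has_derivative_add)
  have "Ck_on k S (dir_deriv v (\<lambda>x. f x + g x))" for v
    using Suc.IH[of "dir_deriv v f" "dir_deriv v g"] Suc.prems 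
      Ck_on_cong[OF assms, of "dir_deriv v (\<lambda>x. f x + g x)" "\<lambda>x. dir_deriv v f x + dir_deriv v g x"] 
      dir_deriv_eqI[OF *] by auto
  then show ?case using * by (auto simp: differentiable_def)
qed

text \<open>The product rule leaves one factor undifferentiated, so the induction step also needs
  \<open>f\<close> and \<open>g\<close> at the lower order; \<open>Ck_on_SucD\<close> supplies
  it.\<close>

lemma Ck_on_bounded_bilinear:
  assumes "bounded_bilinear h" "open S"
  shows "Ck_on k S f \<Longrightarrow> Ck_on k S g \<Longrightarrow> Ck_on k S (\<lambda>x. h (f x) (g x))"
proof (induction k arbitrary: f g)
  case 0
  then show ?case using bounded_bilinear.continuous_on[OF assms(1)] by auto
next
  case (Suc k)
  let ?d = "\<lambda>v x. h (f x) (dir_deriv v g x) + h (dir_deriv v f x) (g x)"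
  have *: "((\<lambda>x. h (f x) (g x)) has_derivative (\<lambda>v. ?d v x)) (at x)" if "x \<in> S" for x
    using Suc.prems that 
    by (auto simp: frechet_derivative_works intro: bounded_bilinear.FDERIV[OF assms(1)])
  have "Ck_on k S (?d v)" for v
    using Suc.prems(1,2)[THEN Ck_on_SucD] Suc.prems by (intro Ck_on_add assms Suc.IH) auto
  then have "Ck_on k S (dir_deriv v (\<lambda>x. h (f x) (g x)))" for v
    using Ck_on_cong[OF assms(2), of "dir_deriv v (\<lambda>x. h (f x) (g x))" "?d v"] 
      dir_deriv_eqI[OF *] by auto
  then show ?case using * by (auto simp: differentiable_def)
qed

lemma Ck_on_const: "Ck_on k S (\<lambda>x. c)"
  by (induction k arbitrary: c) auto

lemma Ck_on_inverse:
  fixes f :: "'a::euclidean_space \<Rightarrow> real"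
  assumes "open S" "\<And>x. x \<in> S \<Longrightarrow> f x \<noteq> 0"
  shows "Ck_on k S f \<Longrightarrow> Ck_on k S (\<lambda>x. inverse (f x))"
proof (induction k)
  case 0
  then show ?case using assms(2) by (auto intro!: continuous_intros)
next
  case (Suc k)
  let ?d = "\<lambda>v x. - 1 * (inverse (f x) * dir_deriv v f x * inverse (f x))"
  have *: "((\<lambda>x. inverse (f x)) has_derivative (\<lambda>v. ?d v x)) (at x)" if "x \<in> S" for x
    using Suc.prems that assms(2) 
    by (auto simp: frechet_derivative_works intro!: derivative_eq_intros)
  have "Ck_on k S (?d v)" for v
    using Ck_on_SucD[OF Suc.prems] Suc.prems
    by (intro Ck_on_bounded_bilinear[OF bounded_bilinear_mult] assms Ck_on_const Suc.IH) auto
  then have "Ck_on k S (dir_deriv v (\<lambda>x. inverse (f x)))" for v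
    using Ck_on_cong[OF assms(1), of "dir_deriv v (\<lambda>x. inverse (f x))" "?d v"] 
      dir_deriv_eqI[OF *] by auto
  then show ?case using * by (auto simp: differentiable_def)
qed

lemma smooth_on_differentiable: "smooth_on S f \<Longrightarrow> x \<in> S \<Longrightarrow> f differentiable (at x)"
  unfolding smooth_on_def by (metis Ck_on.simps(2))

lemma smooth_on_has_derivative:
  "smooth_on S f \<Longrightarrow> x \<in> S \<Longrightarrow> (f has_derivative (\<lambda>v. dir_deriv v f x)) (at x)"
  using smooth_on_differentiable frechet_derivative_works by blast

lemma smooth_on_dir_deriv: "smooth_on S f \<Longrightarrow> smooth_on S (dir_deriv v f)"
  unfolding smooth_on_def by (metis Ck_on.simps(2))

lemma smooth_on_const: "smooth_on S (\<lambda>x. c)"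
  by (simp add: smooth_on_def Ck_on_const)

lemma smooth_on_add: "open S \<Longrightarrow> smooth_on S f \<Longrightarrow> smooth_on S g \<Longrightarrow> smooth_on S (\<lambda>x. f x + g x)"
  by (simp add: smooth_on_def Ck_on_add)

lemma smooth_on_bounded_linear:
  "bounded_linear h \<Longrightarrow> open S \<Longrightarrow> smooth_on S f \<Longrightarrow> smooth_on S (\<lambda>x. h (f x))"
  by (simp add: smooth_on_def Ck_on_bounded_linear)

lemma smooth_on_bounded_bilinear:
  "bounded_bilinear h \<Longrightarrow> open S \<Longrightarrow> smooth_on S f \<Longrightarrow> smooth_on S g \<Longrightarrow> smooth_on S (\<lambda>x. h (f x) (g x))"
  by (simp add: smooth_on_def Ck_on_bounded_bilinear)

lemmas smooth_on_mult = smooth_on_bounded_bilinear[OF bounded_bilinear_mult]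
lemmas smooth_on_scaleR = smooth_on_bounded_bilinear[OF bounded_bilinear_scaleR]
lemmas smooth_on_uminus = smooth_on_bounded_linear[OF bounded_linear_minus[OF bounded_linear_ident]]
lemmas smooth_on_nth = smooth_on_bounded_linear[OF bounded_linear_vec_nth]

lemma smooth_on_diff:
  assumes "open S" "smooth_on S f" "smooth_on S g"
  shows "smooth_on S (\<lambda>x. f x - g x)"
  using smooth_on_add[OF assms(1,2) smooth_on_uminus[OF assms(1,3)]] by simp

lemma smooth_on_inverse:
  fixes f :: "'a::euclidean_space \<Rightarrow> real"
  shows "open S \<Longrightarrow> (\<And>x. x \<in> S \<Longrightarrow> f x \<noteq> 0) \<Longrightarrow> smooth_on S f \<Longrightarrow> smooth_on S (\<lambda>x. inverse (f x))"
  by (simp add: smooth_on_def Ck_on_inverse)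

lemma smooth_on_vector_3:
  fixes f g h :: "'a::euclidean_space \<Rightarrow> real"
  assumes "open S" "smooth_on S f" "smooth_on S g" "smooth_on S h"
  shows "smooth_on S (\<lambda>x. vector [f x, g x, h x] :: real^3)"
proof -
  have "(\<lambda>x. vector [f x, g x, h x] :: real^3) = (\<lambda>x. f x *\<^sub>R axis 1 1 + g x *\<^sub>R axis 2 1 + h x *\<^sub>R axis 3 1)"
    by (auto simp: vec_eq_iff forall_3 axis_def)
  then show ?thesis
    using assms by (auto intro!: smooth_on_add smooth_on_scaleR smooth_on_const)
qed

lemma dir_deriv_nth:
  "f differentiable (at x) \<Longrightarrow> dir_deriv v (\<lambda>x. f x $ i) x = dir_deriv v f x $ i"
  by (rule dir_deriv_eqI[OF bounded_linear.has_derivative[OF bounded_linear_vec_nth]])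
     (simp add: frechet_derivative_works)

text \<open>The second difference over a parallelogram is a difference of increments; the mean value
  theorem is applied first along \<open>v\<close>, then along \<open>w\<close>. This prepares the
  symmetry of second derivatives.\<close>

lemma mixed_difference_MVT:
  fixes f :: "'a::euclidean_space \<Rightarrow> real"
  assumes t: "t > 0" 
    and in_S: "\<And>r s. 0 \<le> r \<Longrightarrow> r \<le> t \<Longrightarrow> 0 \<le> s \<Longrightarrow> s \<le> t \<Longrightarrow> x + r *\<^sub>R v + s *\<^sub>R w \<in> S"
    and f: "\<And>y. y \<in> S \<Longrightarrow> f differentiable (at y)"
    and f': "\<And>y. y \<in> S \<Longrightarrow> dir_deriv v f differentiable (at y)"
  shows "\<exists>r s. 0 \<le> r \<and> r \<le> t \<and> 0 \<le> s \<and> s \<le> t \<and>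
     f (x + t *\<^sub>R v + t *\<^sub>R w) - f (x + t *\<^sub>R v) - f (x + t *\<^sub>R w) + f x =
       t * t * dir_deriv w (dir_deriv v f) (x + r *\<^sub>R v + s *\<^sub>R w)"
proof -
  let ?g = "\<lambda>r. f (x + r *\<^sub>R v + t *\<^sub>R w) - f (x + r *\<^sub>R v)"
  have line: "((\<lambda>r. h (c + r *\<^sub>R u)) has_real_derivative dir_deriv u h (c + r *\<^sub>R u)) (at r)"
    if "h differentiable (at (c + r *\<^sub>R u))" for h :: "'a \<Rightarrow> real" and c u r
  proof -
    have "((\<lambda>r. c + r *\<^sub>R u) has_vector_derivative u) (at r)"
      by (auto intro!: derivative_eq_intros)
    with that have "((h \<circ> (\<lambda>r. c + r *\<^sub>R u)) has_vector_derivative dir_deriv u h (c + r *\<^sub>R u)) (at r)"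
      using vector_derivative_diff_chain_within[of "\<lambda>r. c + r *\<^sub>R u" u r UNIV h "frechet_derivative h (at (c + r *\<^sub>R u))"]
      by (auto simp: frechet_derivative_works intro: has_derivative_at_withinI)
    then show ?thesis by (simp add: has_real_derivative_iff_has_vector_derivative o_def)
  qed
  have "\<exists>r>0. r < t \<and> ?g t - ?g 0 = (t - 0) * (dir_deriv v f (x + r *\<^sub>R v + t *\<^sub>R w) - dir_deriv v f (x + r *\<^sub>R v))"
  proof (rule MVT2[OF t])
    fix r assume r: "0 \<le> r" "r \<le> t"
    have 1: "f differentiable (at (x + t *\<^sub>R w + r *\<^sub>R v))" "f differentiable (at (x + r *\<^sub>R v))"
      using f[OF in_S[of r t]] f[OF in_S[of r 0]] r t by (auto simp: add_ac)
    show "(?g has_real_derivative dir_deriv v f (x + r *\<^sub>R v + t *\<^sub>R w) - dir_deriv v f (x + r *\<^sub>R v)) (at r)"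
      using DERIV_diff[OF line[OF 1(1)] line[OF 1(2)]] by (simp add: add_ac)
  qed
  then obtain r where r: "r > 0" "r < t" and 
    eq: "?g t - ?g 0 = t * (dir_deriv v f (x + r *\<^sub>R v + t *\<^sub>R w) - dir_deriv v f (x + r *\<^sub>R v))"
    by auto
  have "\<exists>s>0. s < t \<and> dir_deriv v f (x + r *\<^sub>R v + t *\<^sub>R w) - dir_deriv v f (x + r *\<^sub>R v + 0 *\<^sub>R w)
     = (t - 0) * dir_deriv w (dir_deriv v f) (x + r *\<^sub>R v + s *\<^sub>R w)"
  proof (rule MVT2[OF t])
    fix s assume "0 \<le> s" "s \<le> t"
    then show "((\<lambda>s. dir_deriv v f (x + r *\<^sub>R v + s *\<^sub>R w)) has_real_derivative
        dir_deriv w (dir_deriv v f) (x + r *\<^sub>R v + s *\<^sub>R w)) (at s)"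
      using line[OF f'[OF in_S[of r s]]] r by auto
  qed
  then obtain s where s: "s > 0" "s < t" and 
    eq2: "dir_deriv v f (x + r *\<^sub>R v + t *\<^sub>R w) - dir_deriv v f (x + r *\<^sub>R v)
     = t * dir_deriv w (dir_deriv v f) (x + r *\<^sub>R v + s *\<^sub>R w)"
    by auto
  have "f (x + t *\<^sub>R v + t *\<^sub>R w) - f (x + t *\<^sub>R v) - f (x + t *\<^sub>R w) + f x = ?g t - ?g 0"
    by simp
  also have "\<dots> = t * t * dir_deriv w (dir_deriv v f) (x + r *\<^sub>R v + s *\<^sub>R w)"
    unfolding eq eq2 by simp
  finally show ?thesis using r s less_imp_le by blast
qed

lemma dir_deriv_commute_real:
  fixes f :: "'a::euclidean_space \<Rightarrow> real"
  assumes S: "open S" "x \<in> S" and f: "smooth_on S f"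
  shows "dir_deriv w (dir_deriv v f) x = dir_deriv v (dir_deriv w f) x"
proof (rule ccontr)
  let ?P = "dir_deriv w (dir_deriv v f)" and ?Q = "dir_deriv v (dir_deriv w f)"
  assume "?P x \<noteq> ?Q x"
  define e where "e = dist (?P x) (?Q x) / 2"
  have e: "e > 0" using \<open>?P x \<noteq> ?Q x\<close> by (simp add: e_def)
  have "isCont ?P x" "isCont ?Q x"
    using smooth_on_differentiable[OF smooth_on_dir_deriv[OF smooth_on_dir_deriv[OF f]] S(2)]
    by (auto intro: differentiable_imp_continuous_within)
  then obtain d1 d2 where d: "d1 > 0" "d2 > 0"
    "\<And>y. dist y x < d1 \<Longrightarrow> dist (?P y) (?P x) < e"
    "\<And>y. dist y x < d2 \<Longrightarrow> dist (?Q y) (?Q x) < e"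
    using e unfolding continuous_at_eps_delta by metis
  obtain d3 where d3: "d3 > 0" "ball x d3 \<subseteq> S" using S open_contains_ball by blast
  define d where "d = min d3 (min d1 d2)"
  have "d > 0" using d d3 by (simp add: d_def)
  \<comment> \<open>With this side length the whole parallelogram lies within distance
    \<open>d\<close> of \<open>x\<close>. The summand 1 excludes division by zero and makes the
    bound strict.\<close>
  define t where "t = d / (norm v + norm w + 1)"
  have pos: "norm v + norm w + 1 > 0" by (simp add: add_nonneg_pos)
  have t: "t > 0" using \<open>d > 0\<close> pos by (simp add: t_def)
  have near: "dist (x + r *\<^sub>R v + s *\<^sub>R w) x < d" if "0 \<le> r" "r \<le> t" "0 \<le> s" "s \<le> t" for r s
  proof -
    have "dist (x + r *\<^sub>R v + s *\<^sub>R w) x = norm (r *\<^sub>R v + s *\<^sub>R w)" by (simp add: dist_norm)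
    also have "\<dots> \<le> r * norm v + s * norm w" using that by (metis norm_triangle_le norm_scaleR abs_of_nonneg order_refl)
    also have "\<dots> \<le> t * norm v + t * norm w" using that by (intro add_mono mult_right_mono) auto
    also have "\<dots> < t * (norm v + norm w + 1)" using t by (simp add: algebra_simps)
    also have "\<dots> = d" using pos by (simp add: t_def)
    finally show ?thesis .
  qed
  have in_S: "x + r *\<^sub>R v + s *\<^sub>R w \<in> S" if "0 \<le> r" "r \<le> t" "0 \<le> s" "s \<le> t" for r s
    using near[OF that] d3(2) by (auto simp: d_def dist_commute subset_iff)
  note diff = smooth_on_differentiable[OF f] smooth_on_differentiable[OF smooth_on_dir_deriv[OF f]]
  obtain r s where rs: "0 \<le> r" "r \<le> t" "0 \<le> s" "s \<le> t"
    and 1: "f (x + t *\<^sub>R v + t *\<^sub>R w) - f (x + t *\<^sub>R v) - f (x + t *\<^sub>R w) + f x = t * t * ?P (x + r *\<^sub>R v + s *\<^sub>R w)"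
    using mixed_difference_MVT[OF t in_S diff] by blast
  \<comment> \<open>Exchanging \<open>v\<close> and \<open>w\<close> does not change the second
    difference, so both iterated derivatives take a common value, at two points near
    \<open>x\<close>.\<close>
  obtain s' r' where rs': "0 \<le> r'" "r' \<le> t" "0 \<le> s'" "s' \<le> t"
    and 2: "f (x + t *\<^sub>R w + t *\<^sub>R v) - f (x + t *\<^sub>R w) - f (x + t *\<^sub>R v) + f x = t * t * ?Q (x + s' *\<^sub>R w + r' *\<^sub>R v)"
  proof -
    have "x + s *\<^sub>R w + r *\<^sub>R v \<in> S" if "0 \<le> s" "s \<le> t" "0 \<le> r" "r \<le> t" for r s
      using in_S[of r s] that by (simp add: add_ac)
    then show ?thesis using mixed_difference_MVT[OF t _ diff] that by blast
  qed
  have "?P (x + r *\<^sub>R v + s *\<^sub>R w) = ?Q (x + r' *\<^sub>R v + s' *\<^sub>R w)"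
  proof -
    have "t * t * ?P (x + r *\<^sub>R v + s *\<^sub>R w) = t * t * ?Q (x + s' *\<^sub>R w + r' *\<^sub>R v)"
      using 1 2 by (simp add: algebra_simps)
    then show ?thesis using t by (simp add: add_ac)
  qed
  moreover have "dist (?P (x + r *\<^sub>R v + s *\<^sub>R w)) (?P x) < e"
    using d(3) near[OF rs] by (simp add: d_def)
  moreover have "dist (?Q (x + r' *\<^sub>R v + s' *\<^sub>R w)) (?Q x) < e"
    using d(4) near[OF rs'] by (simp add: d_def)
  ultimately have "dist (?P x) (?Q x) < e + e" 
    by (smt (verit) dist_triangle2 dist_commute)
  then show False by (simp add: e_def)
qed

lemma dir_deriv_commute:
  fixes f :: "'a::euclidean_space \<Rightarrow> real^'n"
  assumes "open S" "x \<in> S" "smooth_on S f"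
  shows "dir_deriv w (dir_deriv v f) x = dir_deriv v (dir_deriv w f) x"
proof (rule iffD2[OF vec_eq_iff], rule allI)
  fix i
  have *: "dir_deriv w (dir_deriv v f) x $ i = dir_deriv w (dir_deriv v (\<lambda>x. f x $ i)) x" for v w
  proof -
    have "dir_deriv v f differentiable (at x)"
      using smooth_on_differentiable smooth_on_dir_deriv assms by blast
    then have "dir_deriv w (dir_deriv v f) x $ i = dir_deriv w (\<lambda>x. dir_deriv v f x $ i) x"
      by (simp add: dir_deriv_nth)
    also have "\<dots> = dir_deriv w (dir_deriv v (\<lambda>x. f x $ i)) x"
    proof -
      have "(\<lambda>x. dir_deriv v f x $ i) differentiable (at x)"
        using smooth_on_differentiable[OF smooth_on_nth[OF assms(1) smooth_on_dir_deriv[OF assms(3)]] assms(2)] .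
      then show ?thesis
        by (subst frechet_derivative_transform_within_open[OF _ assms(1,2)])
           (auto simp: dir_deriv_nth[OF smooth_on_differentiable[OF assms(3)]])
    qed
    finally show ?thesis .
  qed
  show "dir_deriv w (dir_deriv v f) x $ i = dir_deriv v (dir_deriv w f) x $ i"
    unfolding * by (rule dir_deriv_commute_real[OF assms(1,2) smooth_on_nth[OF assms(1,3)]])
qed

section \<open>The canonical frame\<close>

lemma has_derivative_nth:
  "(f has_derivative f') F \<Longrightarrow> ((\<lambda>x. f x $ i) has_derivative (\<lambda>v. f' v $ i)) F"
  by (rule bounded_linear.has_derivative[OF bounded_linear_vec_nth])

lemma has_derivative_vector_3:
  fixes f g h :: "'a::real_normed_vector \<Rightarrow> real"
  assumes "(f has_derivative f') F" "(g has_derivative g') F" "(h has_derivative h') F"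
  shows "((\<lambda>x. vector [f x, g x, h x] :: real^3) has_derivative (\<lambda>v. vector [f' v, g' v, h' v])) F"
proof -
  have eq: "(vector [a, b, c] :: real^3) = a *\<^sub>R axis 1 1 + b *\<^sub>R axis 2 1 + c *\<^sub>R axis 3 1" for a b c
    by (auto simp: vec_eq_iff forall_3 axis_def)
  show ?thesis
    unfolding eq using assms by (auto intro!: derivative_eq_intros)
qed

definition eta :: "real^3 \<Rightarrow> real^3 \<Rightarrow> real" where
  "eta u v = u$1 * v$1 + u$2 * v$2 - u$3 * v$3"

definition frame :: "real \<Rightarrow> real \<Rightarrow> real^3 \<Rightarrow> real^3 \<Rightarrow> real^3" where
  "frame \<kappa> H p u = vector [lam \<kappa> p * u$1, lam \<kappa> p * u$2,
     u$3 - H * lam \<kappa> p * (p$2 * u$1 - p$1 * u$2)]"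

text \<open>The connection forms come from \<open>d\<theta>\<^sub>1 = (\<kappa>/2) y \<theta>\<^sub>1 \<and> \<theta>\<^sub>2\<close>, \<open>d\<theta>\<^sub>2 = - (\<kappa>/2) x \<theta>\<^sub>1 \<and> \<theta>\<^sub>2\<close> and
  \<open>d\<theta>\<^sub>3 = 2 H \<theta>\<^sub>1 \<and> \<theta>\<^sub>2\<close> for the coframe \<open>(\<theta>\<^sub>1, \<theta>\<^sub>2, \<theta>\<^sub>3) = frame\<close>.\<close>

definition conn :: "real \<Rightarrow> real \<Rightarrow> real^3 \<Rightarrow> real^3 \<Rightarrow> real^3 \<Rightarrow> real^3" where
  "conn \<kappa> H p X V =
     (let q = \<kappa> / 2 * (p$1 * X$2 - p$2 * X$1) + H * X$3
      in vector [q * V$2 + H * X$2 * V$3, - q * V$1 - H * X$1 * V$3, H * X$2 * V$1 - H * X$1 * V$2])"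

text \<open>This is the derivative of \<open>frame \<kappa> H p v\<close> in \<open>p\<close> along
  \<open>u\<close> for fixed \<open>v\<close>; \<open>l\<close> is the derivative of
  \<open>lam\<close> along \<open>u\<close>.\<close>

definition frame_deriv :: "real \<Rightarrow> real \<Rightarrow> real^3 \<Rightarrow> real^3 \<Rightarrow> real^3 \<Rightarrow> real^3" where
  "frame_deriv \<kappa> H p u v =
     (let l = - \<kappa> / 2 * (p$1 * u$1 + p$2 * u$2) * (lam \<kappa> p)\<^sup>2
      in vector [l * v$1, l * v$2,
        - H * l * (p$2 * v$1 - p$1 * v$2) - H * lam \<kappa> p * (u$2 * v$1 - u$1 * v$2)])"

definition frame_inv :: "real \<Rightarrow> real \<Rightarrow> real^3 \<Rightarrow> real^3 \<Rightarrow> real^3" where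
  "frame_inv \<kappa> H p a = vector [a$1 / lam \<kappa> p, a$2 / lam \<kappa> p, a$3 + H * (p$2 * a$1 - p$1 * a$2)]"

text \<open>The index of the determinant is raised with \<open>eta\<close>, which reverses the sign
  of the third component of the Euclidean cross product.\<close>

definition lorentz_cross :: "real^3 \<Rightarrow> real^3 \<Rightarrow> real^3" where
  "lorentz_cross u v = vector [u$2 * v$3 - u$3 * v$2, u$3 * v$1 - u$1 * v$3, u$2 * v$1 - u$1 * v$2]"

lemma bilinear_eta: "bounded_bilinear eta"
proof -
  have "bilinear eta"
    by (auto simp: bilinear_def eta_def algebra_simps intro!: linearI)
  then show ?thesis by (simp add: bilinear_conv_bounded_bilinear)
qed

interpretation eta: bounded_bilinear eta
  by (rule bilinear_eta)

lemma eta_commute: "eta u v = eta v u"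
  by (simp add: eta_def)

lemma bilinear_conn: "bounded_bilinear (conn \<kappa> H p)"
proof -
  have "bilinear (conn \<kappa> H p)"
    by (auto simp: bilinear_def conn_def Let_def vec_eq_iff forall_3 algebra_simps add_divide_distrib intro!: linearI)
  then show ?thesis by (simp add: bilinear_conv_bounded_bilinear)
qed

interpretation conn: bounded_bilinear "conn \<kappa> H p"
  by (rule bilinear_conn)

lemma linear_frame: "linear (frame \<kappa> H p)"
  by (auto simp: frame_def vec_eq_iff forall_3 algebra_simps intro!: linearI)

lemma eta_conn: "eta (conn \<kappa> H p X V) W = - eta V (conn \<kappa> H p X W)"
  by (simp add: eta_def conn_def Let_def algebra_simps)

lemma eta_nondegenerate:
  assumes "\<And>w. eta u w = eta v w"
  shows "u = v"
  using assms[of "axis 1 1"] assms[of "axis 2 1"] assms[of "axis 3 1"]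
  by (simp add: eta_def axis_def vec_eq_iff forall_3)

lemma eta_lorentz_cross: "eta (lorentz_cross u v) w = det (vector [u, v, w] :: real^3^3)"
  by (simp add: eta_def lorentz_cross_def det_3 algebra_simps)

lemma eta_lorentz_cross_self: 
  "eta (lorentz_cross u v) (lorentz_cross u v) = (eta u v)\<^sup>2 - eta u u * eta v v"
  by (simp add: eta_def lorentz_cross_def power2_eq_square algebra_simps)

lemma metric_frame: "metric \<kappa> H p u v = eta (frame \<kappa> H p u) (frame \<kappa> H p v)"
  by (simp add: metric_def frame_def eta_def power2_eq_square algebra_simps)

lemma lam_nonzero: "p \<in> Omega \<kappa> \<Longrightarrow> lam \<kappa> p \<noteq> 0"
  by (auto simp: Omega_def lam_def)

lemma lam_eq: "p \<in> Omega \<kappa> \<Longrightarrow> lam \<kappa> p * (1 + \<kappa> / 4 * ((p$1)\<^sup>2 + (p$2)\<^sup>2)) = 1"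
  by (auto simp: Omega_def lam_def)

lemma frame_frame_inv: "p \<in> Omega \<kappa> \<Longrightarrow> frame \<kappa> H p (frame_inv \<kappa> H p a) = a"
  using lam_nonzero by (auto simp: frame_def frame_inv_def vec_eq_iff forall_3 field_simps)

lemma frame_inv_frame: "p \<in> Omega \<kappa> \<Longrightarrow> frame_inv \<kappa> H p (frame \<kappa> H p a) = a"
  using lam_nonzero by (auto simp: frame_def frame_inv_def vec_eq_iff forall_3 field_simps)

text \<open>Common evaluation of the descriptions behind \<open>cross_product\<close> and
  \<open>christoffel\<close>: once the prescribed functional is written as pairing with
  \<open>a\<close> in the frame, the described vector has components \<open>a\<close>.\<close>

lemma frame_the_metric:
  assumes "p \<in> Omega \<kappa>" "\<And>w. l w = eta a (frame \<kappa> H p w)"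
  shows "frame \<kappa> H p (THE z. \<forall>w. metric \<kappa> H p z w = l w) = a"
proof -
  have "(THE z. \<forall>w. metric \<kappa> H p z w = l w) = frame_inv \<kappa> H p a"
  proof (rule the_equality)
    show "\<forall>w. metric \<kappa> H p (frame_inv \<kappa> H p a) w = l w"
      using assms by (simp add: metric_frame frame_frame_inv)
  next
    fix z assume z: "\<forall>w. metric \<kappa> H p z w = l w"
    have "eta (frame \<kappa> H p z) w = eta a w" for w
      using z[rule_format, of "frame_inv \<kappa> H p w"] assms by (simp add: metric_frame frame_frame_inv)
    then have "frame \<kappa> H p z = a" by (rule eta_nondegenerate)
    then show "z = frame_inv \<kappa> H p a" using frame_inv_frame assms(1) by metis
  qed
  then show ?thesis using frame_frame_inv assms(1) by simp
qed

lemma volume_form_frame: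
  assumes "p \<in> Omega \<kappa>"
  shows "volume_form \<kappa> H p u v w = 
    det (vector [frame \<kappa> H p u, frame \<kappa> H p v, frame \<kappa> H p w] :: real^3^3)"
proof -
  \<comment> \<open>The root of the absolute value is the square of \<open>lam\<close>, which is
    also the positive determinant of \<open>frame\<close>; hence the frame preserves volume and
    orientation.\<close>
  have "det (\<chi> i j. metric \<kappa> H p (axis i 1) (axis j 1) :: real^3^3) = - ((lam \<kappa> p)^4)"
    by (simp add: det_3 metric_def axis_def algebra_simps power2_eq_square power4_eq_xxxx)
  then have "sqrt \<bar>det (\<chi> i j. metric \<kappa> H p (axis i 1) (axis j 1) :: real^3^3)\<bar> = sqrt (((lam \<kappa> p)\<^sup>2)\<^sup>2)"
    by simp
  also have "\<dots> = (lam \<kappa> p)\<^sup>2" by (simp only: real_sqrt_abs) simp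
  finally show ?thesis
    by (simp add: volume_form_def det_3 frame_def algebra_simps power2_eq_square)
qed

lemma frame_cross_product:
  assumes "p \<in> Omega \<kappa>"
  shows "frame \<kappa> H p (cross_product \<kappa> H p u v) = lorentz_cross (frame \<kappa> H p u) (frame \<kappa> H p v)"
  unfolding cross_product_def
  by (rule frame_the_metric) (simp_all add: assms volume_form_frame eta_lorentz_cross)

lemma lam_has_derivative:
  assumes F: "(F has_derivative F') (at z)" and p: "F z \<in> Omega \<kappa>"
  shows "((\<lambda>z. lam \<kappa> (F z)) has_derivative
     (\<lambda>v. - \<kappa> / 2 * (F z $ 1 * F' v $ 1 + F z $ 2 * F' v $ 2) * (lam \<kappa> (F z))\<^sup>2)) (at z)"
proof -
  have "1 + \<kappa> / 4 * ((F z $ 1)\<^sup>2 + (F z $ 2)\<^sup>2) \<noteq> 0"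
    using p by (simp add: Omega_def)
  then show ?thesis
    unfolding lam_def
    by (auto intro!: derivative_eq_intros has_derivative_nth[OF F] simp: fun_eq_iff power2_eq_square algebra_simps)
qed

lemma frame_has_derivative:
  assumes F: "(F has_derivative F') (at z)" and W: "(W has_derivative W') (at z)" and p: "F z \<in> Omega \<kappa>"
  shows "((\<lambda>z. frame \<kappa> H (F z) (W z)) has_derivative
     (\<lambda>v. frame_deriv \<kappa> H (F z) (F' v) (W z) + frame \<kappa> H (F z) (W' v))) (at z)"
proof -
  define l' where "l' v = - \<kappa> / 2 * (F z $ 1 * F' v $ 1 + F z $ 2 * F' v $ 2) * (lam \<kappa> (F z))\<^sup>2" for v
  have l: "((\<lambda>z. lam \<kappa> (F z)) has_derivative l') (at z)"
    unfolding l'_def by (rule lam_has_derivative[OF F p])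
  have fd: "frame_deriv \<kappa> H (F z) (F' v) w = vector [l' v * w$1, l' v * w$2,
      - H * l' v * (F z $ 2 * w$1 - F z $ 1 * w$2) - H * lam \<kappa> (F z) * (F' v $ 2 * w$1 - F' v $ 1 * w$2)]" for v w
    by (simp add: frame_deriv_def l'_def)
  show ?thesis
    unfolding frame_def fd
    apply (rule has_derivative_eq_rhs)
     apply (rule has_derivative_vector_3)
       apply (rule derivative_eq_intros l has_derivative_nth[OF F] has_derivative_nth[OF W] refl)+
    apply (auto simp: fun_eq_iff vec_eq_iff forall_3 algebra_simps)
    done
qed

text \<open>\<open>conn\<close> alone is not symmetric; its skew part cancels the exterior
  derivative of the coframe, which is the skew part of \<open>frame_deriv\<close>.\<close>

lemma frame_torsion_free:
  "frame_deriv \<kappa> H p u v + conn \<kappa> H p (frame \<kappa> H p u) (frame \<kappa> H p v) =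
   frame_deriv \<kappa> H p v u + conn \<kappa> H p (frame \<kappa> H p v) (frame \<kappa> H p u)" if "p \<in> Omega \<kappa>"
proof -
  have l: "lam \<kappa> p * (1 + \<kappa> / 4 * ((p$1)\<^sup>2 + (p$2)\<^sup>2)) = 1" 
    using that by (rule lam_eq)
  have "frame_deriv \<kappa> H p u v $ i + conn \<kappa> H p (frame \<kappa> H p u) (frame \<kappa> H p v) $ i =
   frame_deriv \<kappa> H p v u $ i + conn \<kappa> H p (frame \<kappa> H p v) (frame \<kappa> H p u) $ i" if "i \<noteq> 3" for i
    using that exhaust_3[of i]
    by (auto simp: frame_deriv_def frame_def conn_def Let_def algebra_simps power2_eq_square)
  moreover have "frame_deriv \<kappa> H p u v $ 3 + conn \<kappa> H p (frame \<kappa> H p u) (frame \<kappa> H p v) $ 3 =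
   frame_deriv \<kappa> H p v u $ 3 + conn \<kappa> H p (frame \<kappa> H p v) (frame \<kappa> H p u) $ 3"
  proof -
    \<comment> \<open>The factorization isolates the defining relation of \<open>lam\<close>, so its
      last factor is zero.\<close>
    have "frame_deriv \<kappa> H p u v $ 3 + conn \<kappa> H p (frame \<kappa> H p u) (frame \<kappa> H p v) $ 3 -
        (frame_deriv \<kappa> H p v u $ 3 + conn \<kappa> H p (frame \<kappa> H p v) (frame \<kappa> H p u) $ 3) =
      2 * H * lam \<kappa> p * (u$2 * v$1 - u$1 * v$2) * (lam \<kappa> p * (1 + \<kappa> / 4 * ((p$1)\<^sup>2 + (p$2)\<^sup>2)) - 1)"
      by (simp add: frame_deriv_def frame_def conn_def Let_def field_simps power2_eq_square)
    then show ?thesis by (simp only: l) simp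
  qed
  ultimately show ?thesis
    unfolding vec_eq_iff forall_3 by simp
qed

lemma metric_deriv_frame:
  assumes "p \<in> Omega \<kappa>"
  shows "metric_deriv \<kappa> H p u v w =
    eta (frame_deriv \<kappa> H p u v) (frame \<kappa> H p w) + eta (frame \<kappa> H p v) (frame_deriv \<kappa> H p u w)"
proof -
  have "((\<lambda>q. frame \<kappa> H q v) has_derivative (\<lambda>u. frame_deriv \<kappa> H p u v)) (at p)" for v
    using frame_has_derivative[OF has_derivative_ident has_derivative_const, of p \<kappa> H v] assms
    by (simp add: linear_0[OF linear_frame])
  then show ?thesis
    unfolding metric_deriv_def metric_frame
    by (subst dir_deriv_eqI[OF eta.FDERIV]) auto
qed

text \<open>The Koszul formula is not solved: \<open>G\<close> is symmetric by vanishing torsion and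
  compatible with the metric because \<open>conn\<close> is skew, and these two properties collapse
  the alternating sum to twice \<open>G\<close>.\<close>

lemma frame_christoffel:
  assumes p: "p \<in> Omega \<kappa>"
  shows "frame \<kappa> H p (christoffel \<kappa> H p u v) =
    frame_deriv \<kappa> H p u v + conn \<kappa> H p (frame \<kappa> H p u) (frame \<kappa> H p v)"
proof -
  define G where "G u v = frame_deriv \<kappa> H p u v + conn \<kappa> H p (frame \<kappa> H p u) (frame \<kappa> H p v)" for u v
  have sym: "G u v = G v u" for u v
    unfolding G_def by (rule frame_torsion_free[OF p])
  have md: "metric_deriv \<kappa> H p u v w = eta (G u v) (frame \<kappa> H p w) + eta (frame \<kappa> H p v) (G u w)" for u v w
    using eta_conn[of \<kappa> H p "frame \<kappa> H p u" "frame \<kappa> H p v" "frame \<kappa> H p w"]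
    by (simp add: metric_deriv_frame[OF p] G_def eta.add_left eta.add_right)
  have "metric_deriv \<kappa> H p u v w + metric_deriv \<kappa> H p v u w - metric_deriv \<kappa> H p w u v = 2 * eta (G u v) (frame \<kappa> H p w)" for w
    unfolding md sym[of w] sym[of v u] by (simp add: eta_commute)
  then show ?thesis
    unfolding christoffel_def G_def[symmetric] by (simp add: frame_the_metric[OF p])
qed

text \<open>This is \<open>R(Y, X) V\<close> for \<open>R(Y, X) = [\<nabla>\<^sub>Y, \<nabla>\<^sub>X] - \<nabla>\<^bsub>[Y, X]\<^esub>\<close>, in frame components.\<close>

definition curv :: "real \<Rightarrow> real \<Rightarrow> real^3 \<Rightarrow> real^3 \<Rightarrow> real^3 \<Rightarrow> real^3" where
  "curv \<kappa> H X Y V =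
     (let c1 = X$2 * Y$3 - X$3 * Y$2; c2 = X$3 * Y$1 - X$1 * Y$3; c3 = X$1 * Y$2 - X$2 * Y$1
      in vector [H\<^sup>2 * c2 * V$3 - (\<kappa> + 3 * H\<^sup>2) * c3 * V$2, (\<kappa> + 3 * H\<^sup>2) * c3 * V$1 - H\<^sup>2 * c1 * V$3,
        H\<^sup>2 * c2 * V$1 - H\<^sup>2 * c1 * V$2])"

text \<open>Besides the product rule there is one term from the position-dependent coefficient of
  \<open>conn\<close>, which is linear in the base point.\<close>

lemma conn_has_derivative:
  assumes F: "(F has_derivative F') (at z)" 
    and A: "(A has_derivative A') (at z)" and B: "(B has_derivative B') (at z)"
  shows "((\<lambda>z. conn \<kappa> H (F z) (A z) (B z)) has_derivative
    (\<lambda>v. conn \<kappa> H (F z) (A' v) (B z) + conn \<kappa> H (F z) (A z) (B' v) +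
      (\<kappa> / 2 * (F' v $ 1 * A z $ 2 - F' v $ 2 * A z $ 1)) *\<^sub>R vector [B z $ 2, - B z $ 1, 0])) (at z)"
  unfolding conn_def Let_def
  apply (rule has_derivative_eq_rhs)
   apply (rule has_derivative_vector_3)
     apply (rule derivative_eq_intros has_derivative_nth[OF F] has_derivative_nth[OF A] has_derivative_nth[OF B] refl)+
  apply (auto simp: fun_eq_iff vec_eq_iff forall_3 algebra_simps add_divide_distrib diff_divide_distrib)
  done

lemma curv_conn:
  fixes a b V p :: "real^3" and \<kappa> H :: real
  assumes p: "p \<in> Omega \<kappa>"
  defines "X \<equiv> frame \<kappa> H p a" and "Y \<equiv> frame \<kappa> H p b"
  shows "conn \<kappa> H p (conn \<kappa> H p X Y - conn \<kappa> H p Y X) V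
      + (\<kappa> / 2 * (b$1 * X$2 - b$2 * X$1)) *\<^sub>R vector [V$2, - V$1, 0]
      - (\<kappa> / 2 * (a$1 * Y$2 - a$2 * Y$1)) *\<^sub>R vector [V$2, - V$1, 0]
      + conn \<kappa> H p Y (conn \<kappa> H p X V) - conn \<kappa> H p X (conn \<kappa> H p Y V) = curv \<kappa> H X Y V"
proof -
  have l: "lam \<kappa> p * (1 + \<kappa> / 4 * ((p$1)\<^sup>2 + (p$2)\<^sup>2)) = 1"
    using p by (rule lam_eq)
  \<comment> \<open>\<open>lam\<close> is rational in \<open>p\<close>, but its inverse
    \<open>c\<close> is polynomial. Writing coordinate components as \<open>c\<close> times frame
    components turns the claim into a polynomial identity.\<close>
  define c where "c = 1 + \<kappa> / 4 * ((p$1)\<^sup>2 + (p$2)\<^sup>2)"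
  have "c * (lam \<kappa> p * t) = t" for t
    using l unfolding c_def by (metis mult.assoc mult.commute mult_1)
  then have XY: "a$1 = c * X$1" "a$2 = c * X$2" "b$1 = c * Y$1" "b$2 = c * Y$2"
    by (auto simp: X_def Y_def frame_def)
  show ?thesis
    unfolding XY c_def
    by (simp add: vec_eq_iff forall_3 conn_def curv_def Let_def field_simps power2_eq_square)
qed

text \<open>Expansion of \<open>W\<close> along \<open>a\<close>, \<open>b\<close> and their cross
  product, multiplied by the Gram determinant to avoid division. The minus sign reflects that the
  cross product has square equal to minus that determinant.\<close>

lemma lorentz_expansion:
  "((eta a a * eta b b) - (eta a b)\<^sup>2) *\<^sub>R W = (eta b b * eta W a - eta a b * eta W b) *\<^sub>R a
     + (eta a a * eta W b - eta a b * eta W a) *\<^sub>R b - eta W (lorentz_cross a b) *\<^sub>R lorentz_cross a b"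
  by (simp add: vec_eq_iff forall_3 eta_def lorentz_cross_def power2_eq_square algebra_simps)

lemma lorentz_cross_normal: "eta (lorentz_cross u v) u = 0" "eta (lorentz_cross u v) v = 0"
  by (simp_all add: eta_def lorentz_cross_def algebra_simps)

text \<open>The sign is opposite to that of the Euclidean triple product, which is why
  \<open>N\<close> carries a minus sign and still rotates tangent vectors by multiplication with
  i.\<close>

lemma lorentz_cross_triple:
  "lorentz_cross (lorentz_cross a b) c = eta b c *\<^sub>R a - eta a c *\<^sub>R b"
  by (simp add: vec_eq_iff forall_3 eta_def lorentz_cross_def algebra_simps)

text \<open>The constant-curvature part of \<open>curv\<close> is H^2 times the cross product of
  \<open>lorentz_cross X Y\<close> with \<open>Y\<close>, hence orthogonal to
  \<open>lorentz_cross X Y\<close>. What remains is the vertical component of a triple product,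
  scaled by \<kappa> + 4H^2.\<close>

lemma eta_curv:
  assumes "eta X X = m" "eta Y Y = m" "eta X Y = 0"
  shows "eta (curv \<kappa> H X Y Y) (lorentz_cross X Y) = (\<kappa> + 4 * H\<^sup>2) * m * lorentz_cross X Y $ 3 * - X $ 3"
proof -
  have "eta (curv \<kappa> H X Y Y) (lorentz_cross X Y) = (\<kappa> + 4 * H\<^sup>2) * lorentz_cross X Y $ 3 *
    (X $ 3 * - eta Y Y + Y $ 3 * eta X Y)"
    by (simp add: curv_def eta_def lorentz_cross_def Let_def algebra_simps power2_eq_square)
  then show ?thesis using assms by simp
qed

section \<open>Covariant derivatives along a surface\<close>

locale surface_chart =
  fixes \<kappa> H :: real and U :: "complex set" and F :: "complex \<Rightarrow> real^3"
  assumes open_U: "open U" and smooth_F: "smooth_on U F" and in_Omega: "\<zeta> \<in> U \<Longrightarrow> F \<zeta> \<in> Omega \<kappa>"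
begin

definition X :: "complex \<Rightarrow> complex \<Rightarrow> real^3" where
  "X v \<zeta> = frame \<kappa> H (F \<zeta>) (dF F \<zeta> v)"

definition D :: "complex \<Rightarrow> (complex \<Rightarrow> real^3) \<Rightarrow> complex \<Rightarrow> real^3" where
  "D v V \<zeta> = dir_deriv v V \<zeta> + conn \<kappa> H (F \<zeta>) (X v \<zeta>) (V \<zeta>)"

lemmas smooth_intros = smooth_on_add[OF open_U] smooth_on_diff[OF open_U] smooth_on_mult[OF open_U]
  smooth_on_scaleR[OF open_U] smooth_on_uminus[OF open_U] smooth_on_nth[OF open_U]
  smooth_on_const smooth_on_vector_3[OF open_U] smooth_on_bounded_bilinear[OF bilinear_eta open_U]

lemma smooth_conn:
  "smooth_on U V \<Longrightarrow> smooth_on U W \<Longrightarrow> smooth_on U (\<lambda>\<zeta>. conn \<kappa> H (F \<zeta>) (V \<zeta>) (W \<zeta>))"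
  unfolding conn_def Let_def by (intro smooth_intros smooth_F)

lemma smooth_dF: "smooth_on U (\<lambda>\<zeta>. dF F \<zeta> v)"
  unfolding dF_def by (rule smooth_on_dir_deriv[OF smooth_F])

lemma smooth_lam: "smooth_on U (\<lambda>\<zeta>. lam \<kappa> (F \<zeta>))"
proof -
  have "1 + \<kappa> / 4 * (F \<zeta> $ 1 * F \<zeta> $ 1 + F \<zeta> $ 2 * F \<zeta> $ 2) \<noteq> 0" if "\<zeta> \<in> U" for \<zeta>
    using in_Omega[OF that] by (simp add: Omega_def power2_eq_square)
  then show ?thesis
    unfolding lam_def power2_eq_square by (intro smooth_on_inverse smooth_intros smooth_F open_U)
qed

lemma smooth_X: "smooth_on U (X v)"
  unfolding X_def frame_def by (intro smooth_intros smooth_F smooth_lam smooth_dF)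

lemma smooth_D: "smooth_on U V \<Longrightarrow> smooth_on U (D v V)"
  unfolding D_def by (intro smooth_intros smooth_conn smooth_X smooth_on_dir_deriv)

lemma dir_deriv_cong:
  assumes "\<And>\<zeta>. \<zeta> \<in> U \<Longrightarrow> f \<zeta> = g \<zeta>" "smooth_on U f" "\<zeta> \<in> U"
  shows "dir_deriv v f \<zeta> = dir_deriv v g \<zeta>"
  using frechet_derivative_transform_within_open[OF smooth_on_differentiable[OF assms(2,3)] open_U assms(3,1)]
  by simp

lemma D_cong:
  "(\<And>\<zeta>. \<zeta> \<in> U \<Longrightarrow> V \<zeta> = W \<zeta>) \<Longrightarrow> smooth_on U V \<Longrightarrow> \<zeta> \<in> U \<Longrightarrow> D v V \<zeta> = D v W \<zeta>"
  unfolding D_def by (simp add: dir_deriv_cong)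

lemma dir_deriv_X:
  assumes "\<zeta> \<in> U"
  shows "dir_deriv v (X w) \<zeta> = frame_deriv \<kappa> H (F \<zeta>) (dF F \<zeta> v) (dF F \<zeta> w)
    + frame \<kappa> H (F \<zeta>) (dir_deriv v (\<lambda>z. dF F z w) \<zeta>)"
  unfolding X_def
  using dir_deriv_eqI[OF frame_has_derivative[OF smooth_on_has_derivative[OF smooth_F assms] 
      smooth_on_has_derivative[OF smooth_dF assms] in_Omega[OF assms]]]
  by (simp add: dF_def)

text \<open>Differentiating the frame along \<open>F\<close> yields exactly the
  \<open>frame_deriv\<close> term contained in the Christoffel map, so only \<open>conn\<close>
  survives in \<open>D\<close>.\<close>

lemma frame_cov_deriv:
  assumes "\<zeta> \<in> U"
  shows "frame \<kappa> H (F \<zeta>) (cov_deriv \<kappa> H F \<zeta> v w) = D v (X w) \<zeta>"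
  unfolding cov_deriv_def D_def linear_add[OF linear_frame] frame_christoffel[OF in_Omega[OF assms]]
    dir_deriv_X[OF assms] by (simp add: X_def)

lemma D_X_commute:
  assumes "\<zeta> \<in> U"
  shows "D v (X w) \<zeta> = D w (X v) \<zeta>"
  using frame_torsion_free[OF in_Omega[OF assms], of H "dF F \<zeta> v" "dF F \<zeta> w"]
    dir_deriv_commute[OF open_U assms smooth_F, of v w]
  by (simp add: D_def dir_deriv_X[OF assms] X_def dF_def algebra_simps)

text \<open>\<open>eta\<close> has constant coefficients, and by skewness the two
  \<open>conn\<close> terms hidden in \<open>D\<close> cancel.\<close>

lemma dir_deriv_eta:
  assumes "\<zeta> \<in> U" "smooth_on U V" "smooth_on U W"
  shows "dir_deriv v (\<lambda>\<zeta>. eta (V \<zeta>) (W \<zeta>)) \<zeta> = eta (D v V \<zeta>) (W \<zeta>) + eta (V \<zeta>) (D v W \<zeta>)"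
proof -
  have "dir_deriv v (\<lambda>\<zeta>. eta (V \<zeta>) (W \<zeta>)) \<zeta> = eta (V \<zeta>) (dir_deriv v W \<zeta>) + eta (dir_deriv v V \<zeta>) (W \<zeta>)"
    by (rule dir_deriv_eqI[OF eta.FDERIV]) (use assms smooth_on_has_derivative in auto)
  then show ?thesis
    using eta_conn[of \<kappa> H "F \<zeta>" "X v \<zeta>" "V \<zeta>" "W \<zeta>"]
    by (simp add: D_def eta.add_left eta.add_right)
qed

lemma D_add:
  assumes "\<zeta> \<in> U" "smooth_on U V" "smooth_on U W"
  shows "D v (\<lambda>\<zeta>. V \<zeta> + W \<zeta>) \<zeta> = D v V \<zeta> + D v W \<zeta>"
  using dir_deriv_eqI[OF has_derivative_add[OF smooth_on_has_derivative[OF assms(2,1)] smooth_on_has_derivative[OF assms(3,1)]]]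
  by (simp add: D_def conn.add_right)

lemma D_scaleR:
  assumes "\<zeta> \<in> U" "smooth_on U f" "smooth_on U W"
  shows "D v (\<lambda>\<zeta>. f \<zeta> *\<^sub>R W \<zeta>) \<zeta> = dir_deriv v f \<zeta> *\<^sub>R W \<zeta> + f \<zeta> *\<^sub>R D v W \<zeta>"
  using dir_deriv_eqI[OF has_derivative_scaleR[OF smooth_on_has_derivative[OF assms(2,1)] smooth_on_has_derivative[OF assms(3,1)]]]
  by (simp add: D_def conn.scaleR_right scaleR_add_right)

text \<open>No bracket term occurs, since constant directions in the parameter domain commute. The
  second derivatives of \<open>V\<close> cancel by symmetry, and vanishing torsion reduces the rest
  to the pointwise identity \<open>curv_conn\<close>.\<close>

lemma D_D:
  assumes \<zeta>: "\<zeta> \<in> U" and V: "smooth_on U V"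
  shows "D w (D v V) \<zeta> = D v (D w V) \<zeta> + curv \<kappa> H (X v \<zeta>) (X w \<zeta>) (V \<zeta>)"
proof -
  let ?C = "conn \<kappa> H (F \<zeta>)"
  let ?J = "\<lambda>v w. (\<kappa> / 2 * (dF F \<zeta> w $ 1 * X v \<zeta> $ 2 - dF F \<zeta> w $ 2 * X v \<zeta> $ 1)) *\<^sub>R vector [V \<zeta> $ 2, - V \<zeta> $ 1, 0] :: real^3"
  have *: "D w (D v V) \<zeta> = dir_deriv w (dir_deriv v V) \<zeta> + (?C (dir_deriv w (X v) \<zeta>) (V \<zeta>) 
     + ?C (X v \<zeta>) (dir_deriv w V \<zeta>) + ?J v w)
     + ?C (X w \<zeta>) (dir_deriv v V \<zeta>) + ?C (X w \<zeta>) (?C (X v \<zeta>) (V \<zeta>))" for v w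
  proof -
    have "dir_deriv w (D v V) \<zeta> = dir_deriv w (dir_deriv v V) \<zeta> + (?C (dir_deriv w (X v) \<zeta>) (V \<zeta>) 
     + ?C (X v \<zeta>) (dir_deriv w V \<zeta>) + ?J v w)"
      unfolding D_def dF_def
      by (rule dir_deriv_eqI, rule has_derivative_add, rule smooth_on_has_derivative[OF smooth_on_dir_deriv[OF V] \<zeta>],
          rule conn_has_derivative) (use smooth_on_has_derivative smooth_F V smooth_X \<zeta> in auto)
    then show ?thesis by (simp add: D_def conn.add_right)
  qed
  have "dir_deriv w (X v) \<zeta> - dir_deriv v (X w) \<zeta> = ?C (X v \<zeta>) (X w \<zeta>) - ?C (X w \<zeta>) (X v \<zeta>)"
    using D_X_commute[OF \<zeta>, of v w] by (simp add: D_def algebra_simps)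
  then have eq: "?C (dir_deriv w (X v) \<zeta>) (V \<zeta>) - ?C (dir_deriv v (X w) \<zeta>) (V \<zeta>) 
    = ?C (?C (X v \<zeta>) (X w \<zeta>) - ?C (X w \<zeta>) (X v \<zeta>)) (V \<zeta>)"
    by (simp flip: conn.diff_left)
  have "D w (D v V) \<zeta> - D v (D w V) \<zeta> = ?C (?C (X v \<zeta>) (X w \<zeta>) - ?C (X w \<zeta>) (X v \<zeta>)) (V \<zeta>) 
    + ?J v w - ?J w v + ?C (X w \<zeta>) (?C (X v \<zeta>) (V \<zeta>)) - ?C (X v \<zeta>) (?C (X w \<zeta>) (V \<zeta>))"
    unfolding * eq[symmetric] using dir_deriv_commute[OF open_U \<zeta> V, of v w] by simp
  also have "\<dots> = curv \<kappa> H (X v \<zeta>) (X w \<zeta>) (V \<zeta>)"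
    unfolding X_def by (rule curv_conn[OF in_Omega[OF \<zeta>]])
  finally show ?thesis by (simp add: algebra_simps)
qed

lemma linear_X: "\<zeta> \<in> U \<Longrightarrow> linear (\<lambda>v. X v \<zeta>)"
  unfolding X_def dF_def
  using linear_compose[OF linear_frechet_derivative[OF smooth_on_differentiable[OF smooth_F]] linear_frame]
  by (simp add: o_def)

lemma linear_D: "\<zeta> \<in> U \<Longrightarrow> smooth_on U V \<Longrightarrow> linear (\<lambda>v. D v V \<zeta>)"
  unfolding D_def
  by (intro linear_compose_add linear_frechet_derivative smooth_on_differentiable
      linear_compose[OF linear_X bounded_linear.linear[OF conn.bounded_linear_left], unfolded o_def])

end

section \<open>Cauchy-Riemann equations and the algebra of the final cancellation\<close>

lemma has_field_derivative_of_Cauchy_Riemann: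
  assumes "(f has_derivative f') (at z)" "f' 1 + \<i> * f' \<i> = 0"
  shows "(f has_field_derivative f' 1) (at z)"
proof -
  interpret f': bounded_linear f' using assms(1) by (rule has_derivative_bounded_linear)
  have "\<i> * (f' 1 + \<i> * f' \<i>) = 0"
    unfolding assms(2) by simp
  then have f'_i: "f' \<i> = \<i> * f' 1"
    by (simp add: algebra_simps)
  have "f' v = f' 1 * v" for v
  proof -
    have "f' v = f' (Re v *\<^sub>R 1 + Im v *\<^sub>R \<i>)"
      by (rule arg_cong[of _ _ f']) (simp add: complex_eq_iff)
    also have "\<dots> = f' 1 * (Re v *\<^sub>R 1 + Im v *\<^sub>R \<i>)"
      unfolding f'.add f'.scaleR f'_i by (simp add: algebra_simps)
    also have "Re v *\<^sub>R 1 + Im v *\<^sub>R \<i> = v"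
      by (simp add: complex_eq_iff)
    finally show ?thesis .
  qed
  then have "f' = (*) (f' 1)" by (rule ext)
  then show ?thesis
    unfolding has_field_derivative_def by (rule has_derivative_eq_rhs[OF assms(1)])
qed

lemma ar_form_has_derivative:
  fixes p q r s t :: "complex \<Rightarrow> real"
  assumes "(p has_derivative p') (at z)" "(q has_derivative q') (at z)" "(r has_derivative r') (at z)"
    "(s has_derivative s') (at z)" "(t has_derivative t') (at z)"
  shows "((\<lambda>z. a * (complex_of_real (p z - q z) - 2 * \<i> * complex_of_real (r z))
      + b * (complex_of_real (s z) - \<i> * complex_of_real (t z))\<^sup>2) has_derivative
    (\<lambda>v. a * (complex_of_real (p' v - q' v) - 2 * \<i> * complex_of_real (r' v)) +
       2 * b * (complex_of_real (s z) - \<i> * complex_of_real (t z)) * (complex_of_real (s' v) - \<i> * complex_of_real (t' v)))) (at z)"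
  by (rule has_derivative_eq_rhs, (rule derivative_eq_intros assms refl)+) (simp add: fun_eq_iff algebra_simps)

lemma Cauchy_Riemann_form: 
  "(a * (complex_of_real p1 - 2 * \<i> * complex_of_real r1) + c * (complex_of_real s1 - \<i> * complex_of_real t1))
   + \<i> * (a * (complex_of_real p2 - 2 * \<i> * complex_of_real r2) + c * (complex_of_real s2 - \<i> * complex_of_real t2))
   = a * (complex_of_real (p1 + 2 * r2) + \<i> * complex_of_real (p2 - 2 * r1)) 
    + c * (complex_of_real (s1 + t2) + \<i> * complex_of_real (s2 - t1))"
  by (simp add: algebra_simps)

text \<open>Here \<open>x\<close> and \<open>y\<close> stand for the vertical products of the two
  coordinate fields, \<open>K\<close> for \<kappa> + 4H^2 and \<open>m\<close> for \<mu> times the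
  third component of the normal. The common factor x - iy comes from Codazzi in the first summand
  and from differentiating a square in the second.\<close>

lemma ar_cancellation:
  "a * (complex_of_real (2 * K * m * x) + \<i> * complex_of_real (- 2 * K * m * y))
   + 2 * b * (complex_of_real x - \<i> * complex_of_real y) * (complex_of_real (- 2 * \<tau> * m) + \<i> * complex_of_real (2 * H * m))
  = 2 * complex_of_real m * (complex_of_real x - \<i> * complex_of_real y) * (complex_of_real K * a
             + 2 * \<i> * (complex_of_real H + \<i> * complex_of_real \<tau>) * b)"
  by (simp add: algebra_simps)

context surface_chart
begin

definition \<mu> :: "complex \<Rightarrow> real" where
  "\<mu> \<zeta> = eta (X 1 \<zeta>) (X 1 \<zeta>)"

text \<open>The sign makes this normal upward-pointing if the parameter is positively oriented.\<close>

definition N :: "complex \<Rightarrow> real^3" where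
  "N \<zeta> = - inverse (\<mu> \<zeta>) *\<^sub>R lorentz_cross (X 1 \<zeta>) (X \<i> \<zeta>)"

definition sff :: "complex \<Rightarrow> complex \<Rightarrow> complex \<Rightarrow> real" where
  "sff v w \<zeta> = eta (D v (X w) \<zeta>) (N \<zeta>)"

definition vert :: "complex \<Rightarrow> complex \<Rightarrow> real" where
  "vert v \<zeta> = eta (X v \<zeta>) (axis 3 1)"

text \<open>This is the differential evaluated on \<open>v = w = 1\<close> when J is multiplication
  by i: both arguments become the complex vector X - iY of the coordinate fields.\<close>

definition ar_coeff :: "complex \<Rightarrow> complex \<Rightarrow> complex \<Rightarrow> complex" where
  "ar_coeff a b \<zeta> = a * (complex_of_real (sff 1 1 \<zeta> - sff \<i> \<i> \<zeta>) - 2 * \<i> * complex_of_real (sff 1 \<i> \<zeta>))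
     + b * (complex_of_real (vert 1 \<zeta>) - \<i> * complex_of_real (vert \<i> \<zeta>))\<^sup>2"

lemma sff_commute: "\<zeta> \<in> U \<Longrightarrow> sff v w \<zeta> = sff w v \<zeta>"
  by (simp add: sff_def D_X_commute)

lemma X_eq:
  assumes "\<zeta> \<in> U"
  shows "X v \<zeta> = Re v *\<^sub>R X 1 \<zeta> + Im v *\<^sub>R X \<i> \<zeta>"
proof -
  have "X v \<zeta> = X (Re v *\<^sub>R 1 + Im v *\<^sub>R \<i>) \<zeta>"
    by (rule arg_cong[of _ _ "\<lambda>v. X v \<zeta>"]) (simp add: complex_eq_iff)
  also have "\<dots> = Re v *\<^sub>R X 1 \<zeta> + Im v *\<^sub>R X \<i> \<zeta>"
    by (simp only: linear_add[OF linear_X[OF assms]] linear_scale[OF linear_X[OF assms]])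
  finally show ?thesis .
qed

lemma smooth_\<mu>: "smooth_on U \<mu>"
  unfolding \<mu>_def by (intro smooth_intros smooth_X)

lemma smooth_vert: "smooth_on U (vert v)"
  unfolding vert_def by (intro smooth_intros smooth_X)

end

section \<open>Isothermal parameters: adapted basis and derivatives of the conformal factor\<close>

locale conformal_chart = surface_chart +
  assumes conformal: "\<zeta> \<in> U \<Longrightarrow> eta (X v \<zeta>) (X w \<zeta>) = \<mu> \<zeta> * inner v w"
    and \<mu>_pos: "\<zeta> \<in> U \<Longrightarrow> \<mu> \<zeta> > 0"
begin

lemma smooth_N: "smooth_on U N"
  unfolding N_def lorentz_cross_def
  by (intro smooth_intros smooth_on_inverse smooth_X smooth_\<mu> open_U) (use \<mu>_pos in force)

lemma smooth_sff: "smooth_on U (sff v w)"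
  unfolding sff_def by (intro smooth_intros smooth_D smooth_X smooth_N)

lemma eta_N_X:
  assumes "\<zeta> \<in> U"
  shows "eta (N \<zeta>) (X v \<zeta>) = 0"
  unfolding X_eq[OF assms, of v]
  by (simp add: N_def eta.add_right eta.scaleR_left eta.scaleR_right lorentz_cross_normal eta.minus_left)

lemma eta_N_N:
  assumes "\<zeta> \<in> U"
  shows "eta (N \<zeta>) (N \<zeta>) = -1"
proof -
  have "eta (N \<zeta>) (N \<zeta>) = inverse (\<mu> \<zeta>) * (inverse (\<mu> \<zeta>) * - (\<mu> \<zeta> * \<mu> \<zeta>))"
    by (simp add: N_def eta.scaleR_left eta.scaleR_right eta.minus_left eta.minus_right
        eta_lorentz_cross_self conformal[OF assms])
  also have "\<dots> = -1"
    using \<mu>_pos[OF assms] by (simp add: field_simps)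
  finally show ?thesis .
qed

lemma expansion:
  assumes "\<zeta> \<in> U"
  shows "W = (eta W (X 1 \<zeta>) / \<mu> \<zeta>) *\<^sub>R X 1 \<zeta> + (eta W (X \<i> \<zeta>) / \<mu> \<zeta>) *\<^sub>R X \<i> \<zeta> - eta W (N \<zeta>) *\<^sub>R N \<zeta>"
proof -
  have m: "\<mu> \<zeta> \<noteq> 0" using \<mu>_pos[OF assms] by simp
  have "(\<mu> \<zeta> * \<mu> \<zeta>) *\<^sub>R W = (\<mu> \<zeta> * eta W (X 1 \<zeta>)) *\<^sub>R X 1 \<zeta> + (\<mu> \<zeta> * eta W (X \<i> \<zeta>)) *\<^sub>R X \<i> \<zeta>
    - eta W (lorentz_cross (X 1 \<zeta>) (X \<i> \<zeta>)) *\<^sub>R lorentz_cross (X 1 \<zeta>) (X \<i> \<zeta>)"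
    using lorentz_expansion[of "X 1 \<zeta>" "X \<i> \<zeta>" W] by (simp add: conformal[OF assms])
  also have "\<dots> = (\<mu> \<zeta> * \<mu> \<zeta>) *\<^sub>R ((eta W (X 1 \<zeta>) / \<mu> \<zeta>) *\<^sub>R X 1 \<zeta> + (eta W (X \<i> \<zeta>) / \<mu> \<zeta>) *\<^sub>R X \<i> \<zeta> - eta W (N \<zeta>) *\<^sub>R N \<zeta>)"
    using m by (simp add: N_def scaleR_diff_right scaleR_add_right eta.scaleR_right eta.minus_right field_simps)
  finally show ?thesis using m by simp
qed

lemma eta_expansion:
  assumes "\<zeta> \<in> U"
  shows "eta V W = (eta V (X 1 \<zeta>) * eta W (X 1 \<zeta>) + eta V (X \<i> \<zeta>) * eta W (X \<i> \<zeta>)) / \<mu> \<zeta>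
    - eta V (N \<zeta>) * eta W (N \<zeta>)"
  using arg_cong[OF expansion[OF assms, of V], of "\<lambda>V. eta V W"]
    eta_commute[of W "X 1 \<zeta>"] eta_commute[of W "X \<i> \<zeta>"] eta_commute[of W "N \<zeta>"]
  by (simp add: eta.add_left eta.diff_left eta.scaleR_left add_divide_distrib)

context
  fixes v w
  assumes vw: "v = 1 \<and> w = \<i> \<or> v = \<i> \<and> w = 1"
begin

lemma pair_conformal:
  assumes "\<zeta> \<in> U"
  shows "eta (X v \<zeta>) (X v \<zeta>) = \<mu> \<zeta>" "eta (X w \<zeta>) (X w \<zeta>) = \<mu> \<zeta>" "eta (X v \<zeta>) (X w \<zeta>) = 0"
  using vw assms by (auto simp: conformal)

text \<open>These are the Christoffel symbols of a conformal metric, found by differentiating the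
  three conformality relations and exchanging derivatives with \<open>D_X_commute\<close>. Allowing
  both orders of the pair 1, i lets one argument serve both Codazzi equations.\<close>

lemma pair_D:
  assumes "\<zeta> \<in> U"
  shows "eta (D v (X v) \<zeta>) (X v \<zeta>) = dir_deriv v \<mu> \<zeta> / 2" 
    and "eta (D w (X v) \<zeta>) (X v \<zeta>) = dir_deriv w \<mu> \<zeta> / 2"
    and "eta (D w (X v) \<zeta>) (X w \<zeta>) = dir_deriv v \<mu> \<zeta> / 2"
    and "eta (D v (X v) \<zeta>) (X w \<zeta>) = - dir_deriv w \<mu> \<zeta> / 2"
proof -
  have d: "dir_deriv e \<mu> \<zeta> = 2 * eta (D e (X f) \<zeta>) (X f \<zeta>)" if "f = v \<or> f = w" for e f
  proof -
    have "dir_deriv e \<mu> \<zeta> = dir_deriv e (\<lambda>\<zeta>. eta (X f \<zeta>) (X f \<zeta>)) \<zeta>"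
      by (rule dir_deriv_cong) (use that pair_conformal smooth_\<mu> assms in auto)
    then show ?thesis
      by (simp add: dir_deriv_eta assms smooth_X eta_commute)
  qed
  have "0 = dir_deriv v (\<lambda>\<zeta>. 0 :: real) \<zeta>" by simp
  also have "\<dots> = dir_deriv v (\<lambda>\<zeta>. eta (X v \<zeta>) (X w \<zeta>)) \<zeta>"
    by (rule dir_deriv_cong) (use pair_conformal smooth_on_const assms in auto)
  finally have "eta (D v (X v) \<zeta>) (X w \<zeta>) = - eta (D v (X w) \<zeta>) (X v \<zeta>)"
    by (simp add: dir_deriv_eta assms smooth_X eta_commute)
  then show "eta (D v (X v) \<zeta>) (X v \<zeta>) = dir_deriv v \<mu> \<zeta> / 2" 
    "eta (D w (X v) \<zeta>) (X v \<zeta>) = dir_deriv w \<mu> \<zeta> / 2"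
    "eta (D w (X v) \<zeta>) (X w \<zeta>) = dir_deriv v \<mu> \<zeta> / 2"
    "eta (D v (X v) \<zeta>) (X w \<zeta>) = - dir_deriv w \<mu> \<zeta> / 2"
    using d[of v v] d[of v w] d[of w v] D_X_commute[OF assms, of v w] by auto
qed

end

end

section \<open>Codazzi equation and holomorphy\<close>

locale cmc_chart = conformal_chart +
  fixes \<tau> :: real
  assumes cmc: "\<zeta> \<in> U \<Longrightarrow> sff 1 1 \<zeta> + sff \<i> \<i> \<zeta> = - 2 * \<tau> * \<mu> \<zeta>"
begin

text \<open>By \<open>pair_D\<close> the tangential components of the two summands cancel. The
  normal component -2 \<tau> \<mu> changes sign in \<open>expansion\<close> because \<open>N\<close>
  is timelike.\<close>

lemma mean_curvature_vector:
  assumes "\<zeta> \<in> U" and vw: "v = 1 \<and> w = \<i> \<or> v = \<i> \<and> w = 1"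
  shows "D v (X v) \<zeta> + D w (X w) \<zeta> = (2 * \<tau> * \<mu> \<zeta>) *\<^sub>R N \<zeta>"
proof -
  have a: "1 = 1 \<and> \<i> = \<i> \<or> 1 = \<i> \<and> \<i> = 1" and b: "\<i> = 1 \<and> 1 = \<i> \<or> \<i> = \<i> \<and> 1 = (1::complex)" by auto
  have "D 1 (X 1) \<zeta> + D \<i> (X \<i>) \<zeta> = (2 * \<tau> * \<mu> \<zeta>) *\<^sub>R N \<zeta>"
    by (subst expansion[OF assms(1), of "D 1 (X 1) \<zeta> + D \<i> (X \<i>) \<zeta>"])
       (use cmc[OF assms(1)] in \<open>simp add: eta.add_left pair_D[OF a assms(1)] pair_D[OF b assms(1)] flip: sff_def\<close>)
  then show ?thesis using vw by (auto simp: add.commute)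
qed

lemma eta_D_N:
  assumes "\<zeta> \<in> U"
  shows "eta (D v N \<zeta>) (X w \<zeta>) = - sff v w \<zeta>" "eta (D v N \<zeta>) (N \<zeta>) = 0"
proof -
  have "0 = dir_deriv v (\<lambda>\<zeta>. 0 :: real) \<zeta>" by simp
  also have "\<dots> = dir_deriv v (\<lambda>\<zeta>. eta (N \<zeta>) (X w \<zeta>)) \<zeta>"
    by (rule dir_deriv_cong) (use eta_N_X smooth_on_const assms in auto)
  finally show "eta (D v N \<zeta>) (X w \<zeta>) = - sff v w \<zeta>"
    by (simp add: dir_deriv_eta assms smooth_X smooth_N sff_def eta_commute)
  have "0 = dir_deriv v (\<lambda>\<zeta>. -1 :: real) \<zeta>" by simp
  also have "\<dots> = dir_deriv v (\<lambda>\<zeta>. eta (N \<zeta>) (N \<zeta>)) \<zeta>"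
    by (rule dir_deriv_cong) (use eta_N_N smooth_on_const assms in auto)
  finally show "eta (D v N \<zeta>) (N \<zeta>) = 0"
    by (simp add: dir_deriv_eta assms smooth_N eta_commute)
qed

text \<open>After differentiating the pairings with \<open>N\<close>, the second derivatives add up
  to the Laplacian of \<open>X v\<close>. Commuting them turns it into the derivative of the mean
  curvature vector plus curvature, which is where constancy of \<tau> is used.\<close>

lemma Codazzi:
  assumes \<zeta>: "\<zeta> \<in> U" and vw: "v = 1 \<and> w = \<i> \<or> v = \<i> \<and> w = 1"
  shows "dir_deriv v (sff v v) \<zeta> + dir_deriv w (sff v w) \<zeta> = 
    - \<tau> * dir_deriv v \<mu> \<zeta> + eta (curv \<kappa> H (X v \<zeta>) (X w \<zeta>) (X w \<zeta>)) (N \<zeta>)"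
proof -
  have "dir_deriv w (sff v w) \<zeta> = dir_deriv w (sff w v) \<zeta>"
    by (rule dir_deriv_cong) (use sff_commute smooth_sff \<zeta> in auto)
  then have "dir_deriv v (sff v v) \<zeta> + dir_deriv w (sff v w) \<zeta> =
    eta (D v (D v (X v)) \<zeta> + D w (D w (X v)) \<zeta>) (N \<zeta>) 
     + (eta (D v (X v) \<zeta>) (D v N \<zeta>) + eta (D w (X v) \<zeta>) (D w N \<zeta>))"
    unfolding sff_def by (simp add: dir_deriv_eta \<zeta> smooth_X smooth_D smooth_N eta.add_left)
  also have "eta (D v (D v (X v)) \<zeta> + D w (D w (X v)) \<zeta>) (N \<zeta>) =
    - 2 * \<tau> * dir_deriv v \<mu> \<zeta> + eta (curv \<kappa> H (X v \<zeta>) (X w \<zeta>) (X w \<zeta>)) (N \<zeta>)"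
  proof -
    have "D w (D w (X v)) \<zeta> = D w (D v (X w)) \<zeta>"
      by (rule D_cong) (use D_X_commute smooth_D smooth_X \<zeta> in auto)
    also have "\<dots> = D v (D w (X w)) \<zeta> + curv \<kappa> H (X v \<zeta>) (X w \<zeta>) (X w \<zeta>)"
      by (rule D_D) (use smooth_X \<zeta> in auto)
    finally have "D v (D v (X v)) \<zeta> + D w (D w (X v)) \<zeta> 
      = D v (\<lambda>\<zeta>. D v (X v) \<zeta> + D w (X w) \<zeta>) \<zeta> + curv \<kappa> H (X v \<zeta>) (X w \<zeta>) (X w \<zeta>)"
      by (simp add: D_add \<zeta> smooth_D smooth_X)
    also have "D v (\<lambda>\<zeta>. D v (X v) \<zeta> + D w (X w) \<zeta>) \<zeta> = D v (\<lambda>\<zeta>. (2 * \<tau> * \<mu> \<zeta>) *\<^sub>R N \<zeta>) \<zeta>"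
      by (rule D_cong[OF _ smooth_on_add[OF open_U]])
         (use mean_curvature_vector[OF _ vw] smooth_D smooth_X \<zeta> in auto)
    also have "\<dots> = (2 * \<tau> * dir_deriv v \<mu> \<zeta>) *\<^sub>R N \<zeta> + (2 * \<tau> * \<mu> \<zeta>) *\<^sub>R D v N \<zeta>"
    proof -
      have "dir_deriv v (\<lambda>\<zeta>. 2 * \<tau> * \<mu> \<zeta>) \<zeta> = 2 * \<tau> * dir_deriv v \<mu> \<zeta>"
        by (rule dir_deriv_eqI, rule has_derivative_mult_right, rule smooth_on_has_derivative[OF smooth_\<mu> \<zeta>])
      then show ?thesis
        by (subst D_scaleR[OF \<zeta> _ smooth_N]) (auto intro!: smooth_intros smooth_\<mu>)
    qed
    finally show ?thesis
      by (simp add: eta.add_left eta.scaleR_left eta_N_N eta_D_N \<zeta>)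
  qed
  \<comment> \<open>Expanding in the adapted basis, the terms with \<open>sff v w\<close> cancel by
    symmetry and the rest is a multiple of the trace.\<close>
  also have "eta (D v (X v) \<zeta>) (D v N \<zeta>) + eta (D w (X v) \<zeta>) (D w N \<zeta>) = \<tau> * dir_deriv v \<mu> \<zeta>"
  proof -
    have *: "eta V W = (eta V (X v \<zeta>) * eta W (X v \<zeta>) + eta V (X w \<zeta>) * eta W (X w \<zeta>)) / \<mu> \<zeta>
        - eta V (N \<zeta>) * eta W (N \<zeta>)" for V W
      using eta_expansion[OF \<zeta>, of V W] vw by auto
    have "eta (D v (X v) \<zeta>) (D v N \<zeta>) + eta (D w (X v) \<zeta>) (D w N \<zeta>) =
      - (sff v v \<zeta> + sff w w \<zeta>) * dir_deriv v \<mu> \<zeta> / (2 * \<mu> \<zeta>)"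
      unfolding *[of "D v (X v) \<zeta>" "D v N \<zeta>"] *[of "D w (X v) \<zeta>" "D w N \<zeta>"] pair_D[OF vw \<zeta>] eta_D_N[OF \<zeta>]
      using \<mu>_pos[OF \<zeta>] sff_commute[OF \<zeta>, of v w] by (simp add: field_simps)
    also have "sff v v \<zeta> + sff w w \<zeta> = - 2 * \<tau> * \<mu> \<zeta>"
      using cmc[OF \<zeta>] vw by auto
    finally show ?thesis using \<mu>_pos[OF \<zeta>] by simp
  qed
  finally show ?thesis by simp
qed

lemma eta_curv_N:
  assumes \<zeta>: "\<zeta> \<in> U"
  shows "eta (curv \<kappa> H (X 1 \<zeta>) (X \<i> \<zeta>) (X \<i> \<zeta>)) (N \<zeta>) = (\<kappa> + 4 * H\<^sup>2) * \<mu> \<zeta> * N \<zeta> $ 3 * vert 1 \<zeta>"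
    and "eta (curv \<kappa> H (X \<i> \<zeta>) (X 1 \<zeta>) (X 1 \<zeta>)) (N \<zeta>) = (\<kappa> + 4 * H\<^sup>2) * \<mu> \<zeta> * N \<zeta> $ 3 * vert \<i> \<zeta>"
proof -
  have *: "lorentz_cross (X \<i> \<zeta>) (X 1 \<zeta>) = - lorentz_cross (X 1 \<zeta>) (X \<i> \<zeta>)"
    by (simp add: lorentz_cross_def vec_eq_iff forall_3)
  have v: "vert v \<zeta> = - X v \<zeta> $ 3" for v
    by (simp add: vert_def eta_def axis_def)
  show "eta (curv \<kappa> H (X 1 \<zeta>) (X \<i> \<zeta>) (X \<i> \<zeta>)) (N \<zeta>) = (\<kappa> + 4 * H\<^sup>2) * \<mu> \<zeta> * N \<zeta> $ 3 * vert 1 \<zeta>"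
    using eta_curv[of "X 1 \<zeta>" "\<mu> \<zeta>" "X \<i> \<zeta>" \<kappa> H] \<mu>_pos[OF \<zeta>]
    by (simp add: N_def v conformal[OF \<zeta>] eta.scaleR_right eta.minus_right)
  show "eta (curv \<kappa> H (X \<i> \<zeta>) (X 1 \<zeta>) (X 1 \<zeta>)) (N \<zeta>) = (\<kappa> + 4 * H\<^sup>2) * \<mu> \<zeta> * N \<zeta> $ 3 * vert \<i> \<zeta>"
    using eta_curv[of "X \<i> \<zeta>" "\<mu> \<zeta>" "X 1 \<zeta>" \<kappa> H] \<mu>_pos[OF \<zeta>]
    by (simp add: N_def v conformal[OF \<zeta>] eta.scaleR_right eta.minus_right * field_simps)
qed

text \<open>The vertical field is constant in the frame, so its covariant derivative is only its
  \<open>conn\<close> term, H times a cross product. This term is skew in \<open>v\<close>,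
  \<open>w\<close> (the Killing property): it drops out of the trace, leaving mean curvature, and
  doubles in the difference, where the symmetric \<open>D\<close> terms cancel.\<close>

lemma vert_deriv:
  assumes \<zeta>: "\<zeta> \<in> U"
  shows "dir_deriv 1 (vert 1) \<zeta> + dir_deriv \<i> (vert \<i>) \<zeta> = - 2 * \<tau> * \<mu> \<zeta> * N \<zeta> $ 3"
    and "dir_deriv \<i> (vert 1) \<zeta> - dir_deriv 1 (vert \<i>) \<zeta> = 2 * H * \<mu> \<zeta> * N \<zeta> $ 3"
proof -
  have d: "dir_deriv w (vert v) \<zeta> = - D w (X v) \<zeta> $ 3 + H * (X v \<zeta> $ 1 * X w \<zeta> $ 2 - X v \<zeta> $ 2 * X w \<zeta> $ 1)" for v w
    unfolding vert_def
    by (subst dir_deriv_eta[OF \<zeta> smooth_X smooth_on_const])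
       (simp add: D_def eta_def conn_def Let_def axis_def algebra_simps)
  have "(D 1 (X 1) \<zeta> + D \<i> (X \<i>) \<zeta>) $ 3 = 2 * \<tau> * \<mu> \<zeta> * N \<zeta> $ 3"
    using mean_curvature_vector[OF \<zeta>, of 1 \<i>] by simp
  then show "dir_deriv 1 (vert 1) \<zeta> + dir_deriv \<i> (vert \<i>) \<zeta> = - 2 * \<tau> * \<mu> \<zeta> * N \<zeta> $ 3"
    unfolding d by (simp add: algebra_simps)
  have "2 * H * \<mu> \<zeta> * N \<zeta> $ 3 = 2 * H * (X 1 \<zeta> $ 1 * X \<i> \<zeta> $ 2 - X 1 \<zeta> $ 2 * X \<i> \<zeta> $ 1)"
    using \<mu>_pos[OF \<zeta>] by (simp add: N_def lorentz_cross_def field_simps)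
  then show "dir_deriv \<i> (vert 1) \<zeta> - dir_deriv 1 (vert \<i>) \<zeta> = 2 * H * \<mu> \<zeta> * N \<zeta> $ 3"
    unfolding d D_X_commute[OF \<zeta>, of \<i> 1] by (simp add: algebra_simps)
qed

lemma ar_coeff_holomorphic:
  assumes ab: "complex_of_real (\<kappa> + 4 * H\<^sup>2) * a
             + 2 * \<i> * (complex_of_real H + \<i> * complex_of_real \<tau>) * b = 0"
  shows "ar_coeff a b holomorphic_on U"
proof -
  have "\<exists>d. (ar_coeff a b has_field_derivative d) (at \<zeta>)" if \<zeta>: "\<zeta> \<in> U" for \<zeta>
  proof -
    let ?A = "complex_of_real (vert 1 \<zeta>) - \<i> * complex_of_real (vert \<i> \<zeta>)"
    let ?c = "complex_of_real (\<mu> \<zeta> * N \<zeta> $ 3)"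
    define h' where "h' v = a * (complex_of_real (dir_deriv v (sff 1 1) \<zeta> - dir_deriv v (sff \<i> \<i>) \<zeta>) 
        - 2 * \<i> * complex_of_real (dir_deriv v (sff 1 \<i>) \<zeta>)) 
      + 2 * b * ?A * (complex_of_real (dir_deriv v (vert 1) \<zeta>) - \<i> * complex_of_real (dir_deriv v (vert \<i>) \<zeta>))" for v
    note sd = smooth_sff[THEN smooth_on_has_derivative, OF \<zeta>] smooth_vert[THEN smooth_on_has_derivative, OF \<zeta>]
    have h: "(ar_coeff a b has_derivative h') (at \<zeta>)"
      unfolding ar_coeff_def h'_def
      by (rule ar_form_has_derivative sd)+
    \<comment> \<open>Eliminating this entry by the trace equation produces a derivative of \<mu>
      that cancels the one in \<open>Codazzi\<close>; thus \<open>e1\<close> and \<open>e2\<close>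
      contain curvature only.\<close>
    have sff22: "dir_deriv v (sff \<i> \<i>) \<zeta> = - 2 * \<tau> * dir_deriv v \<mu> \<zeta> - dir_deriv v (sff 1 1) \<zeta>" for v
    proof -
      have "dir_deriv v (sff \<i> \<i>) \<zeta> = dir_deriv v (\<lambda>\<zeta>. - 2 * \<tau> * \<mu> \<zeta> - sff 1 1 \<zeta>) \<zeta>"
        by (rule dir_deriv_cong) (use cmc smooth_sff \<zeta> in \<open>auto simp: algebra_simps\<close>)
      also have "\<dots> = - 2 * \<tau> * dir_deriv v \<mu> \<zeta> - dir_deriv v (sff 1 1) \<zeta>"
        by (rule dir_deriv_eqI, (rule has_derivative_diff has_derivative_mult_right sd smooth_\<mu>[THEN smooth_on_has_derivative, OF \<zeta>])+)
      finally show ?thesis .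
    qed
    have sff21: "dir_deriv v (sff \<i> 1) \<zeta> = dir_deriv v (sff 1 \<i>) \<zeta>" for v
      by (rule dir_deriv_cong) (use sff_commute smooth_sff \<zeta> in auto)
    have e1: "(dir_deriv 1 (sff 1 1) \<zeta> - dir_deriv 1 (sff \<i> \<i>) \<zeta>) + 2 * dir_deriv \<i> (sff 1 \<i>) \<zeta> 
        = 2 * (\<kappa> + 4 * H\<^sup>2) * (\<mu> \<zeta> * N \<zeta> $ 3) * vert 1 \<zeta>"
      using Codazzi[OF \<zeta>, of 1 \<i>] sff22[of 1] eta_curv_N(1)[OF \<zeta>] by (simp add: algebra_simps)
    have e2: "(dir_deriv \<i> (sff 1 1) \<zeta> - dir_deriv \<i> (sff \<i> \<i>) \<zeta>) - 2 * dir_deriv 1 (sff 1 \<i>) \<zeta> 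
        = - 2 * (\<kappa> + 4 * H\<^sup>2) * (\<mu> \<zeta> * N \<zeta> $ 3) * vert \<i> \<zeta>"
      using Codazzi[OF \<zeta>, of \<i> 1] sff22[of \<i>] sff21[of 1] eta_curv_N(2)[OF \<zeta>] by (simp add: algebra_simps)
    have e3: "dir_deriv 1 (vert 1) \<zeta> + dir_deriv \<i> (vert \<i>) \<zeta> = - 2 * \<tau> * (\<mu> \<zeta> * N \<zeta> $ 3)"
      and e4: "dir_deriv \<i> (vert 1) \<zeta> - dir_deriv 1 (vert \<i>) \<zeta> = 2 * H * (\<mu> \<zeta> * N \<zeta> $ 3)"
      using vert_deriv[OF \<zeta>] by simp_all
    have "h' 1 + \<i> * h' \<i> = 
      a * (complex_of_real ((dir_deriv 1 (sff 1 1) \<zeta> - dir_deriv 1 (sff \<i> \<i>) \<zeta>) + 2 * dir_deriv \<i> (sff 1 \<i>) \<zeta>)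
         + \<i> * complex_of_real ((dir_deriv \<i> (sff 1 1) \<zeta> - dir_deriv \<i> (sff \<i> \<i>) \<zeta>) - 2 * dir_deriv 1 (sff 1 \<i>) \<zeta>))
      + 2 * b * ?A * (complex_of_real (dir_deriv 1 (vert 1) \<zeta> + dir_deriv \<i> (vert \<i>) \<zeta>)
         + \<i> * complex_of_real (dir_deriv \<i> (vert 1) \<zeta> - dir_deriv 1 (vert \<i>) \<zeta>))"
      unfolding h'_def by (rule Cauchy_Riemann_form)
    also have "\<dots> = 2 * ?c * ?A * (complex_of_real (\<kappa> + 4 * H\<^sup>2) * a
             + 2 * \<i> * (complex_of_real H + \<i> * complex_of_real \<tau>) * b)"
      unfolding e1 e2 e3 e4 by (rule ar_cancellation)
    finally show ?thesis
      using has_field_derivative_of_Cauchy_Riemann[OF h] ab by auto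
  qed
  then show ?thesis
    by (simp add: holomorphic_on_open[OF open_U])
qed

end

section \<open>Identification of the geometric quantities\<close>

lemma lorentz_cross_scaleR: "lorentz_cross (r *\<^sub>R u) v = r *\<^sub>R lorentz_cross u v"
  by (simp add: lorentz_cross_def vec_eq_iff forall_3 algebra_simps)

lemma frame_E3: "frame \<kappa> H p E3 = axis 3 1"
  by (simp add: frame_def E3_def axis_def vec_eq_iff forall_3)

context surface_chart
begin

lemma first_ff_eq: "first_ff \<kappa> H F \<zeta> v w = eta (X v \<zeta>) (X w \<zeta>)"
  by (simp add: first_ff_def metric_frame X_def)

lemma vert_eq:
  assumes "\<zeta> \<in> U"
  shows "vert v \<zeta> = Re v * vert 1 \<zeta> + Im v * vert \<i> \<zeta>"
  unfolding vert_def X_eq[OF assms, of v] by (simp add: eta.add_left eta.scaleR_left)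

lemma sff_eq:
  assumes \<zeta>: "\<zeta> \<in> U"
  shows "sff v w \<zeta> = Re v * Re w * sff 1 1 \<zeta> + (Re v * Im w + Im v * Re w) * sff 1 \<i> \<zeta> + Im v * Im w * sff \<i> \<i> \<zeta>"
proof -
  have lin: "sff v w \<zeta> = Re v * sff 1 w \<zeta> + Im v * sff \<i> w \<zeta>" for v w
  proof -
    have "D v (X w) \<zeta> = D (Re v *\<^sub>R 1 + Im v *\<^sub>R \<i>) (X w) \<zeta>"
      by (rule arg_cong[of _ _ "\<lambda>v. D v (X w) \<zeta>"]) (simp add: complex_eq_iff)
    also have "\<dots> = Re v *\<^sub>R D 1 (X w) \<zeta> + Im v *\<^sub>R D \<i> (X w) \<zeta>"
      by (simp only: linear_add[OF linear_D[OF \<zeta> smooth_X]] linear_scale[OF linear_D[OF \<zeta> smooth_X]])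
    finally show ?thesis
      by (simp add: sff_def eta.add_left eta.scaleR_left)
  qed
  \<comment> \<open>Only the first slot of \<open>D\<close> is visibly linear; linearity in the
    second argument is obtained from the symmetry of \<open>sff\<close>.\<close>
  have "sff v w \<zeta> = Re v * sff w 1 \<zeta> + Im v * sff w \<i> \<zeta>"
    using lin[of v w] sff_commute[OF \<zeta>, of w v] sff_commute[OF \<zeta>, of w 1] sff_commute[OF \<zeta>, of w \<i>] by metis
  also have "\<dots> = Re v * (Re w * sff 1 1 \<zeta> + Im w * sff \<i> 1 \<zeta>) + Im v * (Re w * sff 1 \<i> \<zeta> + Im w * sff \<i> \<i> \<zeta>)"
    by (simp only: lin[of w])
  finally show ?thesis
    unfolding sff_commute[OF \<zeta>, of \<i> 1] by (simp add: algebra_simps)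
qed

end

context conformal_chart
begin

text \<open>Conformality does not fix the orientation of the parameter, so upwardness has to be
  enforced by the sign. That sign is nonzero because a unit timelike vector has nonzero third
  component. Any competing normal is a multiple of \<open>N\<close>, with factor of square 1 and
  prescribed sign.\<close>

lemma frame_unit_normal:
  assumes \<zeta>: "\<zeta> \<in> U"
  shows "frame \<kappa> H (F \<zeta>) (unit_normal \<kappa> H F \<zeta>) = sgn (N \<zeta> $ 3) *\<^sub>R N \<zeta>"
proof -
  have "(N \<zeta> $ 3)\<^sup>2 = 1 + (N \<zeta> $ 1)\<^sup>2 + (N \<zeta> $ 2)\<^sup>2"
    using eta_N_N[OF \<zeta>] by (simp add: eta_def power2_eq_square)
  then have "(N \<zeta> $ 3)\<^sup>2 > 0" by (smt (verit) zero_le_power2)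
  then have N3: "N \<zeta> $ 3 \<noteq> 0" by simp
  let ?n = "sgn (N \<zeta> $ 3) *\<^sub>R N \<zeta>"
  note m = metric_frame frame_E3 frame_frame_inv[OF in_Omega[OF \<zeta>]]
  have "unit_normal \<kappa> H F \<zeta> = frame_inv \<kappa> H (F \<zeta>) ?n"
    unfolding unit_normal_def
  proof (rule the_equality, intro conjI allI)
    show "metric \<kappa> H (F \<zeta>) (frame_inv \<kappa> H (F \<zeta>) ?n) (frame_inv \<kappa> H (F \<zeta>) ?n) = - 1"
      using N3 by (simp add: m eta.scaleR_left eta.scaleR_right eta_N_N[OF \<zeta>] sgn_if)
    show "metric \<kappa> H (F \<zeta>) (frame_inv \<kappa> H (F \<zeta>) ?n) (dF F \<zeta> v) = 0" for v
      using eta_N_X[OF \<zeta>, of v] by (simp add: m eta.scaleR_left X_def)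
    show "0 < - metric \<kappa> H (F \<zeta>) (frame_inv \<kappa> H (F \<zeta>) ?n) E3"
      using N3 by (simp add: m eta_def axis_def sgn_if)
  next
    fix n
    let ?W = "frame \<kappa> H (F \<zeta>) n"
    assume n: "metric \<kappa> H (F \<zeta>) n n = - 1 \<and> (\<forall>v. metric \<kappa> H (F \<zeta>) n (dF F \<zeta> v) = 0) \<and> 0 < - metric \<kappa> H (F \<zeta>) n E3"
    then have W: "eta ?W ?W = -1" "\<And>v. eta ?W (X v \<zeta>) = 0" "?W $ 3 > 0"
      by (auto simp: m X_def) (auto simp: eta_def axis_def)
    define c where "c = - eta ?W (N \<zeta>)"
    have Wc: "?W = c *\<^sub>R N \<zeta>"
      using expansion[OF \<zeta>, of ?W] by (simp add: W c_def)
    have "c * c = 1"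
      using W(1) unfolding Wc by (simp add: eta.scaleR_left eta.scaleR_right eta_N_N[OF \<zeta>])
    moreover have "c * N \<zeta> $ 3 > 0"
      using W(3) unfolding Wc by simp
    ultimately have "c = sgn (N \<zeta> $ 3)"
      by (auto simp: square_eq_1_iff)
    then have "?W = ?n" using Wc by simp
    then show "n = frame_inv \<kappa> H (F \<zeta>) ?n"
      using frame_inv_frame[OF in_Omega[OF \<zeta>], of H n] by simp
  qed
  then show "frame \<kappa> H (F \<zeta>) (unit_normal \<kappa> H F \<zeta>) = ?n"
    by (simp add: m)
qed

lemma lorentz_cross_N:
  assumes \<zeta>: "\<zeta> \<in> U"
  shows "lorentz_cross (N \<zeta>) (X v \<zeta>) = X (\<i> * v) \<zeta>"
  unfolding N_def lorentz_cross_scaleR lorentz_cross_triple conformal[OF \<zeta>] X_eq[OF \<zeta>, of "\<i> * v"]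
  using \<mu>_pos[OF \<zeta>] by (simp add: inner_complex_def algebra_simps)

lemma X_inj:
  assumes \<zeta>: "\<zeta> \<in> U" and "X v \<zeta> = X w \<zeta>"
  shows "v = w"
proof -
  have "X (v - w) \<zeta> = 0"
    using assms(2) linear_diff[OF linear_X[OF \<zeta>], of v w] by simp
  then have "\<mu> \<zeta> * inner (v - w) (v - w) = 0"
    using conformal[OF \<zeta>, of "v - w" "v - w"] by (simp add: eta.zero_left)
  then show ?thesis using \<mu>_pos[OF \<zeta>] by simp
qed

lemma J_op_eq:
  assumes \<zeta>: "\<zeta> \<in> U"
  shows "J_op \<kappa> H F \<zeta> v = sgn (N \<zeta> $ 3) *\<^sub>R (\<i> * v)"
proof -
  let ?s = "sgn (N \<zeta> $ 3)"
  have "frame \<kappa> H (F \<zeta>) (cross_product \<kappa> H (F \<zeta>) (unit_normal \<kappa> H F \<zeta>) (dF F \<zeta> v)) = ?s *\<^sub>R X (\<i> * v) \<zeta>"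
    by (simp add: frame_cross_product[OF in_Omega[OF \<zeta>]] frame_unit_normal[OF \<zeta>] lorentz_cross_scaleR
        lorentz_cross_N[OF \<zeta>] flip: X_def)
  also have "\<dots> = X (?s *\<^sub>R (\<i> * v)) \<zeta>"
    using linear_scale[OF linear_X[OF \<zeta>], of ?s "\<i> * v"] by simp
  finally have *: "frame \<kappa> H (F \<zeta>) (cross_product \<kappa> H (F \<zeta>) (unit_normal \<kappa> H F \<zeta>) (dF F \<zeta> v)) = X (?s *\<^sub>R (\<i> * v)) \<zeta>" .
  have eq: "dF F \<zeta> w = cross_product \<kappa> H (F \<zeta>) (unit_normal \<kappa> H F \<zeta>) (dF F \<zeta> v) \<longleftrightarrow> 
    X w \<zeta> = X (?s *\<^sub>R (\<i> * v)) \<zeta>" for w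
    unfolding *[symmetric] X_def[of w] using frame_inv_frame[OF in_Omega[OF \<zeta>]] by metis
  show ?thesis
    unfolding J_op_def eq using X_inj[OF \<zeta>] by (intro the_equality) auto
qed

end

section \<open>Positively oriented parameters, in which J is multiplication by i\<close>

locale oriented_conformal_chart = conformal_chart +
  assumes oriented: "\<zeta> \<in> U \<Longrightarrow> v \<noteq> 0 \<Longrightarrow> Im (cnj v * J_op \<kappa> H F \<zeta> v) > 0"
begin

lemma sgn_N: "\<zeta> \<in> U \<Longrightarrow> sgn (N \<zeta> $ 3) = 1"
  using oriented[of \<zeta> 1] by (simp add: J_op_eq sgn_if split: if_splits)

lemma second_ff_eq: "\<zeta> \<in> U \<Longrightarrow> second_ff \<kappa> H F \<zeta> v w = sff v w \<zeta>"
  by (simp add: second_ff_def metric_frame frame_cov_deriv frame_unit_normal sgn_N sff_def)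

lemma cmc_sff:
  assumes \<zeta>: "\<zeta> \<in> U"
    and H: "\<And>e1 e2. first_ff \<kappa> H F \<zeta> e1 e1 = 1 \<Longrightarrow> first_ff \<kappa> H F \<zeta> e2 e2 = 1 \<Longrightarrow>
           first_ff \<kappa> H F \<zeta> e1 e2 = 0 \<Longrightarrow> second_ff \<kappa> H F \<zeta> e1 e1 + second_ff \<kappa> H F \<zeta> e2 e2 = -2 * \<tau>"
  shows "sff 1 1 \<zeta> + sff \<i> \<i> \<zeta> = - 2 * \<tau> * \<mu> \<zeta>"
proof -
  \<comment> \<open>Scaling 1 and i by \<open>r\<close> gives an orthonormal basis of the induced
    metric, to which the trace condition applies.\<close>
  define r where "r = 1 / sqrt (\<mu> \<zeta>)"
  have r: "r * r * \<mu> \<zeta> = 1"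
    using \<mu>_pos[OF \<zeta>] by (simp add: r_def)
  have "second_ff \<kappa> H F \<zeta> (of_real r) (of_real r) + second_ff \<kappa> H F \<zeta> (\<i> * of_real r) (\<i> * of_real r) = -2 * \<tau>"
    by (rule H) (use r in \<open>simp_all add: first_ff_eq conformal[OF \<zeta>] inner_complex_def mult_ac\<close>)
  then have "r * r * (sff 1 1 \<zeta> + sff \<i> \<i> \<zeta>) = - 2 * \<tau>"
    unfolding second_ff_eq[OF \<zeta>] sff_eq[OF \<zeta>, of "of_real r"] sff_eq[OF \<zeta>, of "\<i> * of_real r"]
    by (simp add: algebra_simps)
  then have "r * r * \<mu> \<zeta> * (sff 1 1 \<zeta> + sff \<i> \<i> \<zeta>) = - 2 * \<tau> * \<mu> \<zeta>"
    by (metis mult.assoc mult.commute)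
  then show ?thesis using r by simp
qed

text \<open>As J is multiplication by i, a real-linear form extended to v - iJv takes the value
  (l(1) - i l(i)) v. The dependence on each argument is therefore complex linear, which gives the
  factor \<open>v * w\<close>.\<close>

lemma Q_diff_eq:
  assumes \<zeta>: "\<zeta> \<in> U"
  shows "Q_diff \<kappa> H a b F \<zeta> v w = ar_coeff a b \<zeta> * (v * w)"
proof -
  have J: "J_op \<kappa> H F \<zeta> v = \<i> * v" for v
    by (simp add: J_op_eq[OF \<zeta>] sgn_N[OF \<zeta>])
  have e: "metric \<kappa> H (F \<zeta>) (dF F \<zeta> u) E3 = vert u \<zeta>" for u
    by (simp add: metric_frame frame_E3 vert_def X_def)
  have 1: "cbilin (second_ff \<kappa> H F \<zeta>) (v, - (\<i> * v)) (w, - (\<i> * w)) =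
    (complex_of_real (sff 1 1 \<zeta> - sff \<i> \<i> \<zeta>) - 2 * \<i> * complex_of_real (sff 1 \<i> \<zeta>)) * (v * w)"
    unfolding cbilin_def fst_conv snd_conv second_ff_eq[OF \<zeta>]
      sff_eq[OF \<zeta>, of v] sff_eq[OF \<zeta>, of "- (\<i> * v)"]
    by (simp add: complex_eq_iff algebra_simps)
  have 2: "clin (\<lambda>u. vert u \<zeta>) (v, - (\<i> * v)) = (complex_of_real (vert 1 \<zeta>) - \<i> * complex_of_real (vert \<i> \<zeta>)) * v" for v
    unfolding clin_def fst_conv snd_conv vert_eq[OF \<zeta>, of v] vert_eq[OF \<zeta>, of "- (\<i> * v)"]
    by (simp add: complex_eq_iff algebra_simps)
  show ?thesis
    unfolding Q_diff_def Let_def J e 1 2 ar_coeff_def by (simp add: algebra_simps power2_eq_square)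
qed

end

theorem corollary2p5:
  fixes \<kappa> \<tau> H :: real and a b :: complex
    and T :: "'s topology" and A :: "(complex set \<times> (complex \<Rightarrow> 's)) set"
    and \<phi> :: "'s \<Rightarrow> complex \<times> complex"
  assumes "complex_of_real (\<kappa> + 4 * H\<^sup>2) * a
             + 2 * \<i> * (complex_of_real H + \<i> * complex_of_real \<tau>) * b = 0"
    and "smooth_surface T A"
    and "spacelike_immersion \<kappa> H T A \<phi>"
    and "has_cmc \<kappa> H T A \<phi> \<tau>"
  shows "Q_holomorphic \<kappa> H a b T A \<phi>"
  unfolding Q_holomorphic_def
proof (intro allI impI)
  fix U p \<psi> F
  assume "local_rep \<kappa> H T A \<phi> U p \<psi> F \<and> conformal_rep \<kappa> H U F"
  then have rep: "local_rep \<kappa> H T A \<phi> U p \<psi> F" and conf: "conformal_rep \<kappa> H U F" by auto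
  have "open U" "smooth_on U F" "F ` U \<subseteq> Omega \<kappa>"
    using rep unfolding local_rep_def local_parameters_def is_parametrization_def by blast+
  then have "surface_chart \<kappa> U F"
    unfolding surface_chart_def by (simp add: image_subset_iff)
  then interpret surface_chart \<kappa> H U F .
  have conf': "eta (X v \<zeta>) (X w \<zeta>) = \<mu> \<zeta> * inner v w \<and> \<mu> \<zeta> > 0" if \<zeta>: "\<zeta> \<in> U" for v w \<zeta>
  proof -
    obtain m where "m > 0" and m: "\<And>v w. eta (X v \<zeta>) (X w \<zeta>) = m * inner v w"
      using bspec[OF conf[unfolded conformal_rep_def] \<zeta>, THEN conjunct1] unfolding first_ff_eq by (elim exE conjE) simp
    \<comment> \<open>The pointwise conformal factor is identified at \<open>v = w = 1\<close>, so
      it is given by the smooth function \<mu>.\<close>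
    moreover have "\<mu> \<zeta> = m" by (simp add: \<mu>_def m)
    ultimately show ?thesis by simp
  qed
  interpret oriented_conformal_chart \<kappa> H U F
    by unfold_locales (use conf' conf[unfolded conformal_rep_def] in blast)+
  interpret cmc_chart \<kappa> H U F \<tau>
    by unfold_locales
       (rule cmc_sff, assumption, use assms(4)[unfolded has_cmc_def, rule_format, OF rep] in blast)
  show "\<exists>f. f holomorphic_on U \<and> (\<forall>\<zeta>\<in>U. \<forall>v w. Q_diff \<kappa> H a b F \<zeta> v w = f \<zeta> * (v * w))"
    using ar_coeff_holomorphic[OF assms(1)] Q_diff_eq by blast
qed

end
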